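(* Let $n\ge 1$, $\delta>0$ and $\beta<n+4$. Let $\epsilon_1,\epsilon_2$ be such that $0<\epsilon_1<\epsilon_2<1$. Assume that $f\in H^s(T^n)$ for some $s\in\mathbb{R}$, and for $t\ge 0$ set $$U(t)=\sum_{k\in\mathbb{Z}^n}\hat f_k\,e^{m(\nu_k)t}e^{i\nu_k\cdot x},\qquad V(t)=\sum_{k\in\mathbb{Z}^n}\hat f_k\,m(\nu_k)e^{m(\nu_k)t}e^{i\nu_k\cdot x}.$$ Then for any fixed $t>0$, $U(t)\in H^p(T^n)$ and $V(t)\in H^r(T^n)$, where $$p=\begin{cases}s,&\beta<n,\\ s+\dfrac{4nt}{\delta^2}(1-\epsilon_1),&\beta=n,\\ \infty,&\beta>n,\end{cases}\qquad r=\begin{cases}s,&\beta<n,\\ s+\dfrac{4nt}{\delta^2}(1-\epsilon_2),&\beta=n,\\ \infty,&\beta>n.\end{cases}$$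
   Context: Let $r_1,\dots,r_n>0$ and let $T^n=\prod_{i=1}^n[0,r_i]$ be the periodic torus (opposite faces identified). For $k\in\mathbb{Z}^n$ put $\nu_k=\left(\frac{2\pi k_1}{r_1},\dots,\frac{2\pi k_n}{r_n}\right)$. A periodic distribution $h$ on $T^n$ is written through its Fourier coefficients as $h=\sum_{k\in\mathbb{Z}^n}\hat h_k e^{i\nu_k\cdot x}$. For $s\in\mathbb{R}$, $H^s(T^n)$ is the space of periodic distributions with $\|h\|_{H^s(T^n)}^2:=\sum_{k\in\mathbb{Z}^n}(1+\|k\|^2)^s|\hat h_k|^2<\infty$, and $H^\infty(T^n):=\bigcap_{s\in\mathbb{R}}H^s(T^n)$. For $n\ge1$, $\delta>0$, $\beta<n+4$, the Fourier multiplier is $$m(\nu)=m^{\delta,\beta}(\nu)=-\|\nu\|^2\;{}_2F_3\!\left(1,\tfrac{n+2-\beta}{2};\,2,\tfrac{n+2}{2},\tfrac{n+4-\beta}{2};\,-\tfrac14\|\nu\|^2\delta^2\right),\quad \nu\in\mathbb{R}^n.$$ For $\beta<n+2$ it equals $c^{\delta,\beta}\int_{B_\delta(0)}\frac{\cos(\nu\cdot z)-1}{\|z\|^\beta}dz$ with $c^{\delta,\beta}=\frac{2(n+2-\beta)\Gamma(\frac n2+1)}{\pi^{n/2}\delta^{n+2-\beta}}$; for $\beta=n+2$ it equals $-\|\nu\|^2$. *)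

theory Defs
  imports "HOL-Analysis.Analysis"
begin

definition hypergeometric :: "real list \<Rightarrow> real list \<Rightarrow> real \<Rightarrow> real" where
  "hypergeometric as bs z = eval_fps (fps_hypergeo as bs 1) z"

lemma hypergeometric_2F3:
  "hypergeometric [a1, a2] [b1, b2, b3] z =
     (\<Sum>k. pochhammer a1 k * pochhammer a2 k /
        (pochhammer b1 k * pochhammer b2 k * pochhammer b3 k) * (z ^ k / fact k))"
  by (simp add: hypergeometric_def eval_fps_def)

definition multiplier :: "real \<Rightarrow> real \<Rightarrow> real ^ 'n \<Rightarrow> real" where
  "multiplier \<delta> \<beta> \<nu> = (let n = real CARD('n) in
     - (norm \<nu>)\<^sup>2 *
     hypergeometric [1, (n + 2 - \<beta>) / 2] [2, (n + 2) / 2, (n + 4 - \<beta>) / 2]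
       (- (1 / 4) * (norm \<nu>)\<^sup>2 * \<delta>\<^sup>2))"

definition freq :: "real ^ 'n \<Rightarrow> int ^ 'n \<Rightarrow> real ^ 'n" where
  "freq r k = (\<chi> i. 2 * pi * real_of_int (k $ i) / r $ i)"

text \<open>Functions on the torus are functions on the whole space with period \<open>r $ i\<close> in the
  \<open>i\<close>-th coordinate. A list of indices stands for an iterated partial derivative.\<close>

definition partial_deriv :: "'n \<Rightarrow> (real ^ 'n \<Rightarrow> complex) \<Rightarrow> real ^ 'n \<Rightarrow> complex" where
  "partial_deriv i \<phi> x = vector_derivative (\<lambda>h. \<phi> (x + h *\<^sub>R axis i 1)) (at 0)"

definition iter_partial :: "'n list \<Rightarrow> (real ^ 'n \<Rightarrow> complex) \<Rightarrow> real ^ 'n \<Rightarrow> complex" where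
  "iter_partial is \<phi> = foldr partial_deriv is \<phi>"

definition smooth :: "(real ^ 'n \<Rightarrow> complex) \<Rightarrow> bool" where
  "smooth \<phi> \<longleftrightarrow> (\<forall>is. continuous_on UNIV (iter_partial is \<phi>) \<and>
     (\<forall>i x. (\<lambda>h. iter_partial is \<phi> (x + h *\<^sub>R axis i 1)) differentiable (at (0::real))))"

definition test_functions :: "real ^ 'n \<Rightarrow> (real ^ 'n \<Rightarrow> complex) set" where
  "test_functions r = {\<phi>. smooth \<phi> \<and> (\<forall>x i. \<phi> (x + (r $ i) *\<^sub>R axis i 1) = \<phi> x)}"

definition Ck_norm :: "nat \<Rightarrow> (real ^ 'n \<Rightarrow> complex) \<Rightarrow> real" where
  "Ck_norm N \<phi> = (SUP (is, x) \<in> {is. length is \<le> N} \<times> UNIV. cmod (iter_partial is \<phi> x))"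

text \<open>The smooth periodic functions carry the topology given by the seminorms
  \<^term>\<open>Ck_norm N\<close>; these are increasing in \<open>N\<close>, so a linear functional is continuous iff a
  multiple of one of them bounds it. The values of a distribution outside
  \<^term>\<open>test_functions r\<close> are irrelevant.\<close>

definition periodic_distribution ::
    "real ^ 'n \<Rightarrow> ((real ^ 'n \<Rightarrow> complex) \<Rightarrow> complex) \<Rightarrow> bool" where
  "periodic_distribution r h \<longleftrightarrow>
     (\<forall>\<phi>\<in>test_functions r. \<forall>\<psi>\<in>test_functions r. h (\<lambda>x. \<phi> x + \<psi> x) = h \<phi> + h \<psi>) \<and>
     (\<forall>\<phi>\<in>test_functions r. \<forall>c. h (\<lambda>x. c * \<phi> x) = c * h \<phi>) \<and>
     (\<exists>C N. \<forall>\<phi>\<in>test_functions r. cmod (h \<phi>) \<le> C * Ck_norm N \<phi>)"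

definition fourier_coeff ::
    "real ^ 'n \<Rightarrow> ((real ^ 'n \<Rightarrow> complex) \<Rightarrow> complex) \<Rightarrow> int ^ 'n \<Rightarrow> complex" where
  "fourier_coeff r h k = h (\<lambda>x. cis (- (freq r k \<bullet> x))) / of_real (\<Prod>i\<in>UNIV. r $ i)"

text \<open>The exponential with frequency \<^term>\<open>freq r k\<close>, regarded as a distribution.\<close>

definition exp_distribution ::
    "real ^ 'n \<Rightarrow> int ^ 'n \<Rightarrow> (real ^ 'n \<Rightarrow> complex) \<Rightarrow> complex" where
  "exp_distribution r k \<phi> = integral (cbox 0 r) (\<lambda>x. cis (freq r k \<bullet> x) * \<phi> x)"

text \<open>Trigonometric series are summed unconditionally in the weak sense, that is, after
  application to each test function.\<close>

definition trig_series_converges :: "real ^ 'n \<Rightarrow> (int ^ 'n \<Rightarrow> complex) \<Rightarrow> bool" where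
  "trig_series_converges r a \<longleftrightarrow>
     (\<forall>\<phi>\<in>test_functions r. (\<lambda>k. a k * exp_distribution r k \<phi>) summable_on UNIV)"

definition trig_series ::
    "real ^ 'n \<Rightarrow> (int ^ 'n \<Rightarrow> complex) \<Rightarrow> (real ^ 'n \<Rightarrow> complex) \<Rightarrow> complex" where
  "trig_series r a \<phi> = (\<Sum>\<^sub>\<infinity>k. a k * exp_distribution r k \<phi>)"

definition sobolev ::
    "real ^ 'n \<Rightarrow> real \<Rightarrow> ((real ^ 'n \<Rightarrow> complex) \<Rightarrow> complex) set" where
  "sobolev r s = {h. periodic_distribution r h \<and>
     (\<lambda>k. (1 + (\<Sum>i\<in>UNIV. (real_of_int (k $ i))\<^sup>2)) powr s * (cmod (fourier_coeff r h k))\<^sup>2)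
       summable_on UNIV}"

text \<open>The order may be infinite; at order \<open>- \<infinity>\<close> the union over all orders is taken.\<close>

definition sobolev_ereal ::
    "real ^ 'n \<Rightarrow> ereal \<Rightarrow> ((real ^ 'n \<Rightarrow> complex) \<Rightarrow> complex) set" where
  "sobolev_ereal r p = (case p of ereal s \<Rightarrow> sobolev r s | PInfty \<Rightarrow> (\<Inter>s. sobolev r s)
     | MInfty \<Rightarrow> (\<Union>s. sobolev r s))"

end

theory Submission
  imports Defs
begin

text \<open>Put \<open>a = n/2\<close>, \<open>\<alpha> = (n + 4 - \<beta>)/2\<close>, \<open>z = \<parallel>\<nu>\<parallel>\<^sup>2\<delta>\<^sup>2/4\<close>, let \<open>F z\<close> be the hypergeometric series at \<open>-z\<close> and
  \<open>G z = \<^sub>0F\<^sub>1(; a; -z)\<close>, so that \<open>m = -(4/\<delta>\<^sup>2) z F\<close>. Comparing coefficients,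
  \<open>z (z F' + (\<alpha> - 1) F) = (\<alpha> - 1) a (1 - G)\<close>, which is valid for all \<open>\<alpha> > 0\<close>, and
  \<open>z G'' + a G' + G = 0\<close>. The energy \<open>G\<^sup>2 + z G'\<^sup>2\<close> is nonincreasing, hence \<open>\<bar>G\<bar> \<le> 1\<close> and
  \<open>\<bar>G'\<bar> \<le> z\<close> to the power \<open>-1/2\<close>. Integrating the first equation gives \<open>m \<le> 0\<close>, the logarithmic bound
  \<open>m \<le> K - (2n/\<delta>\<^sup>2) ln (1 + \<parallel>\<nu>\<parallel>\<^sup>2)\<close> for \<open>\<alpha> = 2\<close>, that is \<open>\<beta> = n\<close>, and a power bound for \<open>\<alpha> < 2\<close>.
  Since \<open>\<bar>m\<bar> e\<close> to the power \<open>\<epsilon>mt\<close> is at most \<open>1/(\<epsilon>t)\<close>, the factor \<open>m\<close> in \<open>V\<close> costs only a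
  fraction \<open>\<epsilon>\<close> of the decay of the exponential. That the coefficients of \<open>U(t)\<close> and \<open>V(t)\<close> are the
  prescribed ones follows from integration by parts on the torus: Fourier coefficients of test
  functions decay rapidly, so series with coefficients of polynomial growth converge to
  periodic distributions.\<close>

section \<open>The power series behind the multiplier\<close>

text \<open>The coefficients are dominated by those of \<open>B * exp\<close>, whose series
  converges everywhere.\<close>

lemma fps_conv_radius_infinityI:
  fixes f :: "real fps"
  assumes "\<And>k. \<bar>fps_nth f k\<bar> \<le> B / fact k"
  shows "fps_conv_radius f = \<infinity>"
  unfolding fps_conv_radius_def
proof (rule conv_radius_inftyI'')
  fix z :: real
  have "summable (\<lambda>k. B * (inverse (fact k) * \<bar>z\<bar> ^ k))"
    by (intro summable_mult summable_exp)
  moreover have "norm (fps_nth f k * z ^ k) \<le> B * (inverse (fact k) * \<bar>z\<bar> ^ k)" for k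
  proof -
    have "norm (fps_nth f k * z ^ k) = \<bar>fps_nth f k\<bar> * \<bar>z\<bar> ^ k"
      by (simp add: abs_mult power_abs)
    also have "\<dots> \<le> (B / fact k) * \<bar>z\<bar> ^ k"
      using assms[of k] by (intro mult_right_mono) auto
    finally show ?thesis by (simp add: field_simps)
  qed
  ultimately show "summable (\<lambda>k. fps_nth f k * z ^ k)"
    by (rule summable_comparison_test'[where N = 0]) 
qed

text \<open>All factors \<open>a + j\<close> with \<open>j \<ge> 1\<close> exceed 1, so only the
  first factor can make the product small.\<close>

lemma pochhammer_lower_bound:
  fixes a :: real
  assumes "a > 0"
  shows "min 1 a \<le> pochhammer a k"
proof (cases k)
  case (Suc j)
  have "pochhammer (a + 1) j \<ge> 1"
  proof (induction j)
    case (Suc j)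
    have "1 * 1 \<le> pochhammer (a + 1) j * (a + 1 + real j)"
      using Suc assms by (intro mult_mono) auto
    then show ?case by (simp add: pochhammer_Suc)
  qed simp
  then have "a * 1 \<le> a * pochhammer (a + 1) j" using assms by (intro mult_left_mono) auto
  then show ?thesis using Suc by (simp add: pochhammer_rec)
qed simp

text \<open>The last argument \<open>-1\<close> moves the sign of the hypergeometric argument into
  the coefficients, so that this series and the next are studied at
  \<open>z \<ge> 0\<close>.\<close>

definition bessel_fps :: "real \<Rightarrow> real fps" where
  "bessel_fps a = fps_hypergeo [] [a] (-1)"

definition symbol_fps :: "real \<Rightarrow> real \<Rightarrow> real fps" where
  "symbol_fps a \<alpha> = fps_hypergeo [1, \<alpha> - 1] [2, a + 1, \<alpha>] (-1)"

lemma bessel_fps_nth: "fps_nth (bessel_fps a) k = (-1) ^ k / (pochhammer a k * fact k)"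
  by (simp add: bessel_fps_def)

lemma pochhammer_two: "pochhammer (2::real) k = fact (Suc k)"
proof -
  have "pochhammer (1::real) (Suc k) = pochhammer 2 k" by (simp add: pochhammer_rec)
  then show ?thesis by (simp add: pochhammer_fact)
qed

lemma symbol_fps_nth:
  "fps_nth (symbol_fps a \<alpha>) k =
     pochhammer (\<alpha> - 1) k * (-1) ^ k / (pochhammer (a + 1) k * pochhammer \<alpha> k * fact (Suc k))"
  by (simp add: symbol_fps_def pochhammer_two pochhammer_fact[symmetric] del: fact_Suc)

text \<open>Both sides are \<open>pochhammer (\<alpha> - 1) (Suc k)\<close>, with the last or the
  first factor split off. The product form also covers \<open>\<alpha> = 1\<close>,
  \<open>k = 0\<close>, where \<open>\<alpha> - 1 + k\<close> vanishes.\<close>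

lemma pochhammer_shift: "pochhammer (\<alpha> - 1 :: real) k * (\<alpha> - 1 + real k) = (\<alpha> - 1) * pochhammer \<alpha> k"
  using pochhammer_rec[of "\<alpha> - 1" k] by (simp add: pochhammer_Suc)

lemma fps_conv_radius_bessel_fps:
  assumes "a > 0" shows "fps_conv_radius (bessel_fps a) = \<infinity>"
proof (rule fps_conv_radius_infinityI[where B = "1 / min 1 a"])
  fix k
  have "min 1 a > 0" "min 1 a \<le> pochhammer a k" using assms pochhammer_lower_bound by auto
  then show "\<bar>fps_nth (bessel_fps a) k\<bar> \<le> 1 / min 1 a / fact k"
    by (auto simp: bessel_fps_nth abs_mult intro!: divide_left_mono mult_right_mono)
qed

text \<open>The quotient of the two Pochhammer symbols in \<alpha> collapses to
  \<open>(\<alpha> - 1) / (\<alpha> + j)\<close> at \<open>k = Suc j\<close>, which is bounded in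
  \<open>j\<close>.\<close>

lemma fps_conv_radius_symbol_fps:
  assumes "a > 0" "\<alpha> > 0" shows "fps_conv_radius (symbol_fps a \<alpha>) = \<infinity>"
proof (rule fps_conv_radius_infinityI[where B = "max 1 (\<bar>\<alpha> - 1\<bar> / \<alpha>)"])
  fix k
  have p: "pochhammer \<alpha> k > 0" using assms by (simp add: pochhammer_pos)
  have q: "1 \<le> pochhammer (a + 1) k" using pochhammer_lower_bound[of "a + 1" k] assms by auto
  have *: "\<bar>pochhammer (\<alpha> - 1) k / pochhammer \<alpha> k\<bar> \<le> max 1 (\<bar>\<alpha> - 1\<bar> / \<alpha>)"
  proof (cases k)
    case (Suc j)
    have "pochhammer (\<alpha> - 1) k / pochhammer \<alpha> k = (\<alpha> - 1) / (\<alpha> + real j)"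
      using pochhammer_shift[of \<alpha> k] p Suc assms by (simp add: field_simps)
    moreover have "\<bar>\<alpha> - 1\<bar> / (\<alpha> + real j) \<le> \<bar>\<alpha> - 1\<bar> / \<alpha>"
      using assms by (intro divide_left_mono) auto
    ultimately show ?thesis using assms by (simp add: le_max_iff_disj)
  qed simp
  have "1 * fact k \<le> pochhammer (a + 1) k * fact (Suc k)"
    using q by (intro mult_mono) (auto intro: fact_mono)
  have "\<bar>fps_nth (symbol_fps a \<alpha>) k\<bar> =
      \<bar>pochhammer (\<alpha> - 1) k / pochhammer \<alpha> k\<bar> / (pochhammer (a + 1) k * fact (Suc k))"
    using p q by (simp add: symbol_fps_nth abs_mult divide_simps del: fact_Suc)
  also have "\<dots> \<le> max 1 (\<bar>\<alpha> - 1\<bar> / \<alpha>) / fact k"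
    using * \<open>1 * fact k \<le> _\<close> by (intro frac_le) (auto simp: le_max_iff_disj)
  finally show "\<bar>fps_nth (symbol_fps a \<alpha>) k\<bar> \<le> max 1 (\<bar>\<alpha> - 1\<bar> / \<alpha>) / fact k" .
qed

section \<open>Differential equations of the two series\<close>

lemma bessel_fps_Suc:
  assumes "a > 0"
  shows "fps_nth (bessel_fps a) (Suc k) * ((a + real k) * real (Suc k)) = - fps_nth (bessel_fps a) k"
proof -
  have "pochhammer a k > 0" "a + real k > 0" using assms by (auto intro: pochhammer_pos)
  then show ?thesis by (simp add: bessel_fps_nth pochhammer_Suc divide_simps)
qed

lemma fps_deriv_bessel_fps:
  assumes "a > 0"
  shows "fps_deriv (bessel_fps a) = fps_const (- 1 / a) * bessel_fps (a + 1)"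
proof (rule fps_ext)
  fix k
  have "pochhammer (a + 1) k > 0" using assms by (auto intro: pochhammer_pos)
  then show "fps_nth (fps_deriv (bessel_fps a)) k = fps_nth (fps_const (- 1 / a) * bessel_fps (a + 1)) k"
    using assms by (simp add: bessel_fps_nth pochhammer_rec divide_simps)
qed

lemma bessel_fps_ode:
  assumes "a > 0"
  shows "fps_X * fps_deriv (fps_deriv (bessel_fps a)) + fps_const a * fps_deriv (bessel_fps a)
    + bessel_fps a = 0"
proof (rule fps_ext)
  fix k
  show "fps_nth (fps_X * fps_deriv (fps_deriv (bessel_fps a)) + fps_const a * fps_deriv (bessel_fps a)
    + bessel_fps a) k = fps_nth 0 k"
    using bessel_fps_Suc[OF assms, of k]
    by (cases k) (simp_all add: algebra_simps)
qed

text \<open>The operator \<open>z d/dz + (\<alpha> - 1)\<close> multiplies the coefficient of index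
  \<open>j\<close> by \<open>\<alpha> - 1 + j\<close>. This removes the Pochhammer symbols in
  \<alpha>, and what remains is a shifted coefficient of \<open>1 - bessel_fps a\<close>.\<close>

lemma symbol_fps_ode:
  assumes "a > 0" "\<alpha> > 0"
  shows "fps_X * (fps_X * fps_deriv (symbol_fps a \<alpha>) + fps_const (\<alpha> - 1) * symbol_fps a \<alpha>)
    = fps_const ((\<alpha> - 1) * a) * (1 - bessel_fps a)"
proof (rule fps_ext)
  fix k
  show "fps_nth (fps_X * (fps_X * fps_deriv (symbol_fps a \<alpha>) + fps_const (\<alpha> - 1) * symbol_fps a \<alpha>)) k
    = fps_nth (fps_const ((\<alpha> - 1) * a) * (1 - bessel_fps a)) k"
  proof (cases k)
    case 0
    then show ?thesis by (simp add: bessel_fps_nth)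
  next
    case (Suc j)
    have pos: "pochhammer (a + 1) j > 0" "pochhammer \<alpha> j > 0"
      using assms by (auto intro: pochhammer_pos)
    have "fps_nth (fps_X * (fps_X * fps_deriv (symbol_fps a \<alpha>) + fps_const (\<alpha> - 1) * symbol_fps a \<alpha>)) k
      = (\<alpha> - 1 + real j) * fps_nth (symbol_fps a \<alpha>) j"
      using Suc by (cases j) (simp_all add: algebra_simps)
    also have "\<dots> = (pochhammer (\<alpha> - 1) j * (\<alpha> - 1 + real j)) * (-1) ^ j /
        (pochhammer (a + 1) j * pochhammer \<alpha> j * fact (Suc j))"
      by (simp add: symbol_fps_nth mult_ac del: fact_Suc)
    also have "\<dots> = (\<alpha> - 1) * (-1) ^ j / (pochhammer (a + 1) j * fact (Suc j))"
      unfolding pochhammer_shift using pos by simp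
    also have "\<dots> = fps_nth (fps_const ((\<alpha> - 1) * a) * (1 - bessel_fps a)) k"
      using Suc assms pos by (simp add: bessel_fps_nth pochhammer_rec field_simps del: fact_Suc)
    finally show ?thesis .
  qed
qed

text \<open>\<open>bessel a z\<close> is \<open>\<^sub>0F\<^sub>1(; a; -z)\<close>, a rescaled Bessel function of order \<open>a - 1\<close>.\<close>

definition bessel :: "real \<Rightarrow> real \<Rightarrow> real" where
  "bessel a z = eval_fps (bessel_fps a) z"

definition symbol_series :: "real \<Rightarrow> real \<Rightarrow> real \<Rightarrow> real" where
  "symbol_series a \<alpha> z = eval_fps (symbol_fps a \<alpha>) z"

lemma bessel_0 [simp]: "bessel a 0 = 1"
  by (simp add: bessel_def eval_fps_at_0 bessel_fps_nth)

lemma symbol_series_0 [simp]: "symbol_series a \<alpha> 0 = 1"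
  by (simp add: symbol_series_def eval_fps_at_0 symbol_fps_nth)

lemma bessel_has_derivative:
  assumes "a > 0"
  shows "(bessel a has_field_derivative - bessel (a + 1) z / a) (at z within A)"
proof -
  have "(eval_fps (bessel_fps a) has_field_derivative eval_fps (fps_deriv (bessel_fps a)) z) (at z within A)"
    using assms by (intro has_field_derivative_eval_fps) (auto simp: fps_conv_radius_bessel_fps)
  moreover have "eval_fps (fps_deriv (bessel_fps a)) z = - bessel (a + 1) z / a"
    unfolding fps_deriv_bessel_fps[OF assms] bessel_def
    using assms by (subst eval_fps_mult) (auto simp: fps_conv_radius_bessel_fps)
  ultimately show ?thesis unfolding bessel_def[abs_def] by simp
qed

text \<open>This is \<open>z G'' + a G' + G = 0\<close> with the derivatives of \<open>G\<close>
  expressed by raised parameters.\<close>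

lemma bessel_recurrence:
  assumes "a > 0"
  shows "z * bessel (a + 2) z / (a * (a + 1)) - bessel (a + 1) z + bessel a z = 0"
proof -
  have 1: "eval_fps (fps_deriv (bessel_fps a)) z = - bessel (a + 1) z / a"
    unfolding fps_deriv_bessel_fps[OF assms] bessel_def
    using assms by (subst eval_fps_mult) (auto simp: fps_conv_radius_bessel_fps)
  have "fps_deriv (fps_deriv (bessel_fps a)) = fps_const (1 / (a * (a + 1))) * bessel_fps (a + 1 + 1)"
    using assms by (simp add: fps_deriv_bessel_fps mult.assoc[symmetric] fps_const_mult[symmetric] del: fps_const_mult)
  then have 2: "eval_fps (fps_deriv (fps_deriv (bessel_fps a))) z = bessel (a + 2) z / (a * (a + 1))"
    using assms by (simp add: eval_fps_mult fps_conv_radius_bessel_fps bessel_def add.assoc)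
  have r0: "fps_conv_radius (bessel_fps a) = \<infinity>" using assms by (simp add: fps_conv_radius_bessel_fps)
  have r1: "fps_conv_radius (fps_deriv (bessel_fps a)) = \<infinity>"
    using fps_conv_radius_deriv[of "bessel_fps a"] r0 by simp
  have r2: "fps_conv_radius (fps_deriv (fps_deriv (bessel_fps a))) = \<infinity>"
    using fps_conv_radius_deriv[of "fps_deriv (bessel_fps a)"] r1 by simp
  have r3: "fps_conv_radius (fps_X * fps_deriv (fps_deriv (bessel_fps a))) = \<infinity>"
    using fps_conv_radius_mult[of fps_X "fps_deriv (fps_deriv (bessel_fps a))"] r2 by simp
  have r4: "fps_conv_radius (fps_const a * fps_deriv (bessel_fps a)) = \<infinity>"
    using fps_conv_radius_mult[of "fps_const a" "fps_deriv (bessel_fps a)"] r1 by simp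
  have r5: "fps_conv_radius (fps_X * fps_deriv (fps_deriv (bessel_fps a)) + fps_const a * fps_deriv (bessel_fps a)) = \<infinity>"
    using fps_conv_radius_add[of "fps_X * fps_deriv (fps_deriv (bessel_fps a))" "fps_const a * fps_deriv (bessel_fps a)"]
      r3 r4 by simp
  have "eval_fps (fps_X * fps_deriv (fps_deriv (bessel_fps a)) + fps_const a * fps_deriv (bessel_fps a)
    + bessel_fps a) z = z * (bessel (a + 2) z / (a * (a + 1))) + a * (- bessel (a + 1) z / a) + bessel a z"
    by (simp add: eval_fps_add eval_fps_mult r0 r1 r2 r3 r4 r5 1 2 bessel_def)
  then show ?thesis using assms by (simp add: bessel_fps_ode)
qed

text \<open>The equation degenerates to \<open>0 = 0\<close> at the origin, so the slope there is
  supplied separately; its sign decides the behaviour near 0 when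
  \<open>\<alpha> < 1\<close>.\<close>

lemma symbol_series_has_derivative:
  assumes "a > 0" "\<alpha> > 0"
  obtains D where "\<And>z A. (symbol_series a \<alpha> has_field_derivative D z) (at z within A)"
    and "\<And>z. z * (z * D z + (\<alpha> - 1) * symbol_series a \<alpha> z) = (\<alpha> - 1) * a * (1 - bessel a z)"
    and "D 0 = (1 - \<alpha>) / (2 * (a + 1) * \<alpha>)"
proof
  let ?f = "symbol_fps a \<alpha>" and ?g = "bessel_fps a"
  let ?D = "eval_fps (fps_deriv ?f)"
  have r0: "fps_conv_radius ?f = \<infinity>" using assms by (rule fps_conv_radius_symbol_fps)
  have r1: "fps_conv_radius (fps_deriv ?f) = \<infinity>"
    using fps_conv_radius_deriv[of ?f] r0 by simp
  have r2: "fps_conv_radius (fps_X * fps_deriv ?f) = \<infinity>"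
    using fps_conv_radius_mult[of fps_X "fps_deriv ?f"] r1 by simp
  have r3: "fps_conv_radius (fps_const (\<alpha> - 1) * ?f) = \<infinity>"
    using fps_conv_radius_mult[of "fps_const (\<alpha> - 1)" ?f] r0 by simp
  have r4: "fps_conv_radius (fps_X * fps_deriv ?f + fps_const (\<alpha> - 1) * ?f) = \<infinity>"
    using fps_conv_radius_add[of "fps_X * fps_deriv ?f" "fps_const (\<alpha> - 1) * ?f"] r2 r3 by simp
  have r5: "fps_conv_radius ?g = \<infinity>" using assms by (simp add: fps_conv_radius_bessel_fps)
  have r6: "fps_conv_radius (1 - ?g) = \<infinity>"
    using fps_conv_radius_diff[of 1 ?g] r5 by simp
  show "(symbol_series a \<alpha> has_field_derivative ?D z) (at z within A)" for z A
    unfolding symbol_series_def[abs_def] using r0 by (intro has_field_derivative_eval_fps) auto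
  show "z * (z * ?D z + (\<alpha> - 1) * symbol_series a \<alpha> z) = (\<alpha> - 1) * a * (1 - bessel a z)" for z
    using arg_cong[OF symbol_fps_ode[OF assms], of "\<lambda>f. eval_fps f z"]
    by (simp add: eval_fps_add eval_fps_mult eval_fps_diff r0 r1 r2 r3 r4 r5 r6 symbol_series_def bessel_def)
  have "?D 0 = (\<alpha> - 1) * - 1 / ((a + 1) * \<alpha> * 2)"
    by (simp add: eval_fps_at_0 symbol_fps_nth numeral_2_eq_2)
  then show "?D 0 = (1 - \<alpha>) / (2 * (a + 1) * \<alpha>)" by (simp add: mult_ac)
qed

section \<open>Growth of the multiplier\<close>

text \<open>The left-hand side is \<open>G\<^sup>2 + z G'\<^sup>2\<close>, whose derivative is \<open>(1 - 2a) G'\<^sup>2\<close>.\<close>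

lemma bessel_energy:
  assumes "a \<ge> 1 / 2" "z \<ge> 0"
  shows "(bessel a z)\<^sup>2 + z * (bessel (a + 1) z / a)\<^sup>2 \<le> 1"
proof -
  let ?E = "\<lambda>z. (bessel a z)\<^sup>2 + z * (bessel (a + 1) z / a)\<^sup>2"
  have "?E z \<le> ?E 0"
  proof (rule DERIV_nonpos_imp_nonincreasing[OF \<open>z \<ge> 0\<close>])
    fix x :: real
    assume x: "0 \<le> x" "x \<le> z"
    define g b1 b2 where "g = bessel a x" and "b1 = bessel (a + 1) x" and "b2 = bessel (a + 2) x"
    have a: "a > 0" using assms by simp
    have d1: "(bessel a has_field_derivative - b1 / a) (at x)"
      unfolding b1_def using a by (rule bessel_has_derivative)
    have d2: "(bessel (a + 1) has_field_derivative - b2 / (a + 1)) (at x)"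
      using bessel_has_derivative[of "a + 1"] a by (simp add: b2_def add.assoc)
    have "x * b2 / (a * (a + 1)) = b1 - g"
      using bessel_recurrence[OF a, of x] by (simp add: g_def b1_def b2_def algebra_simps)
    then have rec: "x * b2 = (b1 - g) * (a * (a + 1))"
      using a nonzero_divide_eq_eq[of "a * (a + 1)" "x * b2" "b1 - g"] by auto
    have deriv: "(?E has_field_derivative (2 * g * (- b1 / a) + ((b1 / a)\<^sup>2 + x * (2 * (b1 / a) * (- b2 / (a + 1) / a))))) (at x)"
      using a by (auto intro!: derivative_eq_intros d1 d2 simp: g_def b1_def mult_ac)
    have "2 * g * (- b1 / a) + ((b1 / a)\<^sup>2 + x * (2 * (b1 / a) * (- b2 / (a + 1) / a)))
      = 2 * g * (- b1 / a) + ((b1 / a)\<^sup>2 - 2 * b1 * (x * b2) / (a\<^sup>2 * (a + 1)))"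
      by (simp add: power2_eq_square mult_ac)
    \<comment> \<open>Eliminating \<open>b2\<close> by the recurrence cancels the mixed terms
      \<open>g * b1\<close>. The remaining factor has the right sign because
      \<open>a \<ge> 1 / 2\<close>.\<close>
    also have "\<dots> = - (2 * a - 1) * (b1 / a)\<^sup>2"
      unfolding rec using a by (simp add: divide_simps power2_eq_square) algebra
    also have "\<dots> \<le> 0" using assms by (intro mult_nonpos_nonneg) auto
    also note sign = calculation
    show "\<exists>y. (?E has_field_derivative y) (at x) \<and> y \<le> 0" by (rule exI, rule conjI, rule deriv, rule sign)
  qed
  then show ?thesis by simp
qed

lemma abs_bessel_le_1:
  assumes "a \<ge> 1 / 2" "z \<ge> 0" shows "\<bar>bessel a z\<bar> \<le> 1"
proof -
  have "0 \<le> z * (bessel (a + 1) z / a)\<^sup>2" using assms by simp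
  then have "(bessel a z)\<^sup>2 \<le> 1" using bessel_energy[OF assms] by linarith
  then show ?thesis by (simp add: abs_square_le_1)
qed

text \<open>The energy bound without its first term, since \<open>bessel (a + 1)\<close> is
  \<open>- a G'\<close>.\<close>

lemma bessel_decay:
  assumes "a \<ge> 1 / 2" "z > 0" shows "\<bar>bessel (a + 1) z\<bar> \<le> a * z powr (- 1 / 2)"
proof -
  have "0 \<le> (bessel a z)\<^sup>2" by simp
  then have "z * (bessel (a + 1) z / a)\<^sup>2 \<le> 1" using bessel_energy[of a z] assms by linarith
  then have "(bessel (a + 1) z / a)\<^sup>2 \<le> 1 / z" using assms by (simp add: field_simps)
  then have "\<bar>bessel (a + 1) z / a\<bar> \<le> sqrt (1 / z)"
    by (metis real_sqrt_abs real_sqrt_le_mono)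
  also have "\<dots> = z powr (- 1 / 2)"
    using assms by (simp add: powr_minus_divide powr_half_sqrt real_sqrt_divide)
  finally show ?thesis using assms by (simp add: field_simps)
qed

text \<open>The difference of the two sides vanishes at 0 and has derivative
  \<open>1 - bessel (a + 1)\<close>, which is nonnegative. It controls the correction by \<kappa>
  when \<open>\<alpha> < 1\<close>.\<close>

lemma one_minus_bessel_le:
  assumes "a \<ge> 1 / 2" "z \<ge> 0" shows "a * (1 - bessel a z) \<le> z"
proof -
  let ?h = "\<lambda>z. z - a * (1 - bessel a z)"
  have "?h 0 \<le> ?h z"
  proof (rule DERIV_nonneg_imp_nondecreasing[OF \<open>z \<ge> 0\<close>])
    fix x :: real
    assume x: "0 \<le> x" "x \<le> z"
    have d1: "(bessel a has_field_derivative - bessel (a + 1) x / a) (at x)"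
      using assms by (intro bessel_has_derivative) auto
    have deriv: "(?h has_field_derivative 1 - bessel (a + 1) x) (at x)"
      using assms by (auto intro!: derivative_eq_intros d1)
    have sign: "1 - bessel (a + 1) x \<ge> 0" using abs_bessel_le_1[of "a + 1" x] assms x by auto
    show "\<exists>y. (?h has_field_derivative y) (at x) \<and> 0 \<le> y" by (rule exI, rule conjI, rule deriv, rule sign)
  qed
  then show ?thesis by simp
qed

text \<open>Subtracting the leading term \<open>1\<close> when \<open>\<alpha> < 1\<close> makes the derivative below nonnegative for
  all \<open>\<alpha>\<close>.\<close>

lemma symbol_series_weighted_mono:
  assumes a: "a \<ge> 1 / 2" and \<alpha>: "\<alpha> > 0" and xy: "0 < x" "x \<le> y"
    and \<kappa>: "\<kappa> = (if \<alpha> < 1 then 1 else 0)"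
  shows "x powr (\<alpha> - 1) * (symbol_series a \<alpha> x - \<kappa>) \<le> y powr (\<alpha> - 1) * (symbol_series a \<alpha> y - \<kappa>)"
proof -
  have "a > 0" using a by simp
  from symbol_series_has_derivative[OF this \<alpha>]
  obtain D where D: "\<And>z. (symbol_series a \<alpha> has_field_derivative D z) (at z)"
    and ode: "\<And>z. z * (z * D z + (\<alpha> - 1) * symbol_series a \<alpha> z) = (\<alpha> - 1) * a * (1 - bessel a z)"
    by metis
  show ?thesis
  proof (rule DERIV_nonneg_imp_nondecreasing[OF \<open>x \<le> y\<close>, of "\<lambda>z. z powr (\<alpha> - 1) * (symbol_series a \<alpha> z - \<kappa>)"])
    fix z assume "x \<le> z" "z \<le> y"
    then have z: "z > 0" using xy by simp
    have deriv: "((\<lambda>z. z powr (\<alpha> - 1) * (symbol_series a \<alpha> z - \<kappa>)) has_field_derivative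
      (z powr (\<alpha> - 1) * D z + (\<alpha> - 1) * z powr (\<alpha> - 1 - 1) * (symbol_series a \<alpha> z - \<kappa>))) (at z)"
      using z by (auto intro!: derivative_eq_intros D)
    \<comment> \<open>The weight is the integrating factor of the equation, so the series and its
      derivative enter only through the left side of the equation.\<close>
    have "z powr (\<alpha> - 1) * D z + (\<alpha> - 1) * z powr (\<alpha> - 1 - 1) * (symbol_series a \<alpha> z - \<kappa>)
      = z powr (\<alpha> - 1) / z\<^sup>2 * (z * (z * D z + (\<alpha> - 1) * symbol_series a \<alpha> z) - (\<alpha> - 1) * \<kappa> * z)"
      using z by (simp add: powr_diff field_simps power2_eq_square)
    also have "\<dots> = z powr (\<alpha> - 1) / z\<^sup>2 * ((\<alpha> - 1) * (a * (1 - bessel a z) - \<kappa> * z))"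
      unfolding ode by (simp add: algebra_simps)
    also have "\<dots> \<ge> 0"
    proof -
      have "(\<alpha> - 1) * (a * (1 - bessel a z) - \<kappa> * z) \<ge> 0"
      proof (cases "\<alpha> < 1")
        case True
        then show ?thesis using one_minus_bessel_le[OF a, of z] z
          by (intro mult_nonpos_nonpos) (auto simp: \<kappa>)
      next
        case False
        then show ?thesis using abs_bessel_le_1[OF a, of z] z \<open>a > 0\<close> by (simp add: \<kappa>)
      qed
      then show ?thesis by simp
    qed
    also note sign = calculation
    show "\<exists>d. ((\<lambda>z. z powr (\<alpha> - 1) * (symbol_series a \<alpha> z - \<kappa>)) has_field_derivative d) (at z) \<and> 0 \<le> d"
      by (rule exI, rule conjI, rule deriv, rule sign)
  qed
qed

text \<open>Starting point for the monotonicity. At 0 the series equals 1: for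
  \<open>\<alpha> < 1\<close> this is \<kappa> itself and the positive slope is needed, otherwise
  \<open>\<kappa> = 0\<close> and continuity suffices.\<close>

lemma symbol_series_gt_near_0:
  assumes a: "a > 0" and \<alpha>: "\<alpha> > 0" and \<kappa>: "\<kappa> = (if \<alpha> < 1 then 1 else 0)"
  obtains d where "d > 0" and "\<And>z. 0 < z \<Longrightarrow> z < d \<Longrightarrow> symbol_series a \<alpha> z > \<kappa>"
proof -
  from symbol_series_has_derivative[OF a \<alpha>]
  obtain D where D: "\<And>z. (symbol_series a \<alpha> has_field_derivative D z) (at z)"
    and D0: "D 0 = (1 - \<alpha>) / (2 * (a + 1) * \<alpha>)"
    by metis
  show ?thesis
  proof (cases "\<alpha> < 1")
    case True
    have "D 0 > 0" using True a \<alpha> by (simp add: D0)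
    from DERIV_pos_inc_right[OF D this] show ?thesis
      using that True by (auto simp: \<kappa>)
  next
    case False
    have "isCont (symbol_series a \<alpha>) 0" using D by (rule DERIV_isCont)
    then have "\<forall>e>0. \<exists>d>0. \<forall>z. dist z 0 < d \<longrightarrow> dist (symbol_series a \<alpha> z) (symbol_series a \<alpha> 0) < e"
      by (simp add: continuous_at_eps_delta)
    then obtain d where d: "d > 0" "\<And>z. \<bar>z\<bar> < d \<Longrightarrow> \<bar>symbol_series a \<alpha> z - 1\<bar> < 1"
      by (metis dist_real_def symbol_series_0 diff_zero zero_less_one)
    show ?thesis
    proof (rule that[OF d(1)])
      fix z assume "0 < z" "z < d"
      then show "symbol_series a \<alpha> z > \<kappa>" using d(2)[of z] False by (simp add: \<kappa>)
    qed
  qed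
qed

text \<open>The weighted difference is positive close to 0 and nondecreasing, hence positive at
  every \<open>z > 0\<close>.\<close>

lemma symbol_series_nonneg:
  assumes a: "a \<ge> 1 / 2" and \<alpha>: "\<alpha> > 0" and "z \<ge> 0"
  shows "symbol_series a \<alpha> z \<ge> 0"
proof (cases "z = 0")
  case False
  then have z: "z > 0" using assms by simp
  define \<kappa> :: real where \<kappa>: "\<kappa> = (if \<alpha> < 1 then 1 else 0)"
  obtain d where d: "d > 0" "\<And>z. 0 < z \<Longrightarrow> z < d \<Longrightarrow> symbol_series a \<alpha> z > \<kappa>"
    using symbol_series_gt_near_0[of a \<alpha> \<kappa>] a \<alpha> \<kappa> by auto
  define x where "x = min z (d / 2)"
  have x: "0 < x" "x \<le> z" "x < d" using z d by (auto simp: x_def)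
  have "0 < x powr (\<alpha> - 1) * (symbol_series a \<alpha> x - \<kappa>)" using x d by simp
  also have "\<dots> \<le> z powr (\<alpha> - 1) * (symbol_series a \<alpha> z - \<kappa>)"
    using symbol_series_weighted_mono[OF a \<alpha> x(1,2) \<kappa>] .
  finally have "symbol_series a \<alpha> z > \<kappa>" using z by (simp add: zero_less_mult_iff)
  then show ?thesis by (auto simp: \<kappa> split: if_splits)
qed simp

text \<open>The monotone quantity is frozen at one point \<open>x \<le> 1\<close>; multiplying by
  \<open>z powr (2 - \<alpha>)\<close> then undoes the weight up to a factor
  \<open>z\<close>.\<close>

lemma symbol_series_lower_bound:
  assumes a: "a \<ge> 1 / 2" and \<alpha>: "\<alpha> > 0"
  obtains c where "c > 0" and "\<And>z. z \<ge> 1 \<Longrightarrow> z * symbol_series a \<alpha> z \<ge> c * z powr (2 - \<alpha>)"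
proof -
  define \<kappa> :: real where \<kappa>: "\<kappa> = (if \<alpha> < 1 then 1 else 0)"
  obtain d where d: "d > 0" "\<And>z. 0 < z \<Longrightarrow> z < d \<Longrightarrow> symbol_series a \<alpha> z > \<kappa>"
    using symbol_series_gt_near_0[of a \<alpha> \<kappa>] a \<alpha> \<kappa> by auto
  define x where "x = min 1 (d / 2)"
  have x: "0 < x" "x \<le> 1" "x < d" using d by (auto simp: x_def)
  define c where "c = x powr (\<alpha> - 1) * (symbol_series a \<alpha> x - \<kappa>)"
  show ?thesis
  proof (rule that[of c])
    show "c > 0" using x d by (simp add: c_def)
    fix z :: real assume z: "z \<ge> 1"
    have "c \<le> z powr (\<alpha> - 1) * (symbol_series a \<alpha> z - \<kappa>)"
      unfolding c_def using symbol_series_weighted_mono[OF a \<alpha> x(1) _ \<kappa>, of z] x z by simp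
    also have "\<dots> \<le> z powr (\<alpha> - 1) * symbol_series a \<alpha> z"
      by (intro mult_left_mono) (auto simp: \<kappa>)
    finally have "c * z powr (2 - \<alpha>) \<le> z powr (\<alpha> - 1) * symbol_series a \<alpha> z * z powr (2 - \<alpha>)"
      by (intro mult_right_mono) auto
    also have "\<dots> = z powr (\<alpha> - 1 + (2 - \<alpha>)) * symbol_series a \<alpha> z" by (simp only: powr_add mult_ac)
    also have "\<dots> = z * symbol_series a \<alpha> z" using z by simp
    finally show "z * symbol_series a \<alpha> z \<ge> c * z powr (2 - \<alpha>)" .
  qed
qed

text \<open>A crude bound, enough for polynomial growth of the multiplier. Up to 1 it is
  compactness; beyond, the weighted series is compared with a multiple of
  \<open>z powr \<alpha>\<close>.\<close>

lemma symbol_series_upper_bound: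
  assumes a: "a \<ge> 1 / 2" and \<alpha>: "\<alpha> > 0"
  obtains C where "\<And>z. z \<ge> 0 \<Longrightarrow> symbol_series a \<alpha> z \<le> C * (1 + z)"
proof -
  have "a > 0" using a by simp
  from symbol_series_has_derivative[OF this \<alpha>]
  obtain D where D: "\<And>z. (symbol_series a \<alpha> has_field_derivative D z) (at z)"
    and ode: "\<And>z. z * (z * D z + (\<alpha> - 1) * symbol_series a \<alpha> z) = (\<alpha> - 1) * a * (1 - bessel a z)"
    by metis
  \<comment> \<open>Bounds the right side of the equation, as \<open>1 - bessel a z\<close> is at
    most 2.\<close>
  define A where "A = 2 * a * \<bar>\<alpha> - 1\<bar>"
  have "continuous_on {0..1} (symbol_series a \<alpha>)"
    using D by (intro continuous_at_imp_continuous_on ballI DERIV_isCont)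
  then have "bounded (symbol_series a \<alpha> ` {0..1})"
    by (intro compact_imp_bounded compact_continuous_image) auto
  then obtain B where B: "\<And>z. 0 \<le> z \<Longrightarrow> z \<le> 1 \<Longrightarrow> \<bar>symbol_series a \<alpha> z\<bar> \<le> B"
    by (force simp: bounded_iff)
  have "B \<ge> 0" using B[of 0] by simp
  \<comment> \<open>With this choice \<open>E * z powr \<alpha>\<close> has derivative
    \<open>A * z powr (\<alpha> - 1)\<close>.\<close>
  define E where "E = A / \<alpha>"
  have "E \<ge> 0" using \<open>a > 0\<close> \<alpha> by (simp add: A_def E_def)
  show ?thesis
  proof (rule that[of "B + E"])
    fix z :: real assume "z \<ge> 0"
    show "symbol_series a \<alpha> z \<le> (B + E) * (1 + z)"
    proof (cases "z \<le> 1")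
      case True
      have "symbol_series a \<alpha> z \<le> B + E" using B[of z] True \<open>z \<ge> 0\<close> \<open>E \<ge> 0\<close> by auto
      also have "\<dots> = (B + E) * 1" by simp
      also have "\<dots> \<le> (B + E) * (1 + z)"
        using \<open>B \<ge> 0\<close> \<open>E \<ge> 0\<close> \<open>z \<ge> 0\<close> by (intro mult_left_mono) auto
      finally show ?thesis .
    next
      case False
      let ?h = "\<lambda>z. z powr (\<alpha> - 1) * symbol_series a \<alpha> z - E * z powr \<alpha>"
      have "?h z \<le> ?h 1"
      proof (rule DERIV_nonpos_imp_nonincreasing[where f = ?h])
        fix x :: real assume x: "1 \<le> x" "x \<le> z"
        have deriv: "(?h has_field_derivative
          (x powr (\<alpha> - 1) * D x + (\<alpha> - 1) * x powr (\<alpha> - 1 - 1) * symbol_series a \<alpha> x - E * (\<alpha> * x powr (\<alpha> - 1)))) (at x)"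
          using x by (auto intro!: derivative_eq_intros D)
        have "x powr (\<alpha> - 1) * D x + (\<alpha> - 1) * x powr (\<alpha> - 1 - 1) * symbol_series a \<alpha> x - E * (\<alpha> * x powr (\<alpha> - 1))
          = x powr (\<alpha> - 1) / x\<^sup>2 * (x * (x * D x + (\<alpha> - 1) * symbol_series a \<alpha> x) - A * x\<^sup>2)"
        proof -
          have "x powr (\<alpha> - 1 - 1) = x powr (\<alpha> - 1) / x"
            using x powr_diff[of x "\<alpha> - 1" 1] by simp
          moreover have "E * (\<alpha> * x powr (\<alpha> - 1)) = A * x powr (\<alpha> - 1)" using \<alpha> by (simp add: E_def)
          moreover have "p * d + (\<alpha> - 1) * (p / x) * F - A * p = p / x\<^sup>2 * (x * (x * d + (\<alpha> - 1) * F) - A * x\<^sup>2)"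
            for p d F
            using x by (simp add: field_simps power2_eq_square)
          ultimately show ?thesis by (simp only:)
        qed
        also have "\<dots> \<le> 0"
        proof -
          have "(\<alpha> - 1) * a * (1 - bessel a x) \<le> \<bar>\<alpha> - 1\<bar> * a * 2"
            using abs_bessel_le_1[OF a, of x] x \<open>a > 0\<close> by (intro mult_mono) auto
          also have "\<dots> = A * 1" by (simp add: A_def)
          also have "\<dots> \<le> A * x\<^sup>2" using x \<open>a > 0\<close> by (intro mult_left_mono) (auto simp: A_def)
          finally show ?thesis unfolding ode by (intro mult_nonneg_nonpos) auto
        qed
        also note sign = calculation
        show "\<exists>y. (?h has_field_derivative y) (at x) \<and> y \<le> 0" by (rule exI, rule conjI, rule deriv, rule sign)
      qed (use False in simp)
      then have "z powr (\<alpha> - 1) * symbol_series a \<alpha> z \<le> B + E * z powr \<alpha>"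
        using B[of 1] \<open>E \<ge> 0\<close> by simp
      then have "z powr (1 - \<alpha>) * (z powr (\<alpha> - 1) * symbol_series a \<alpha> z) \<le> z powr (1 - \<alpha>) * (B + E * z powr \<alpha>)"
        by (intro mult_left_mono) auto
      moreover have "z powr (1 - \<alpha>) * (z powr (\<alpha> - 1) * symbol_series a \<alpha> z) = symbol_series a \<alpha> z"
      proof -
        have "z powr (1 - \<alpha>) * z powr (\<alpha> - 1) = 1" using False by (subst powr_add[symmetric]) simp
        then show ?thesis by (simp add: mult.assoc[symmetric])
      qed
      moreover have "z powr (1 - \<alpha>) * (B + E * z powr \<alpha>) = B * z powr (1 - \<alpha>) + E * z"
      proof -
        have "z powr (1 - \<alpha>) * z powr \<alpha> = z" using False by (subst powr_add[symmetric]) simp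
        then show ?thesis by (simp add: distrib_left mult_ac)
      qed
      moreover have "B * z powr (1 - \<alpha>) \<le> B * z powr 1"
        using False \<alpha> \<open>B \<ge> 0\<close> by (intro mult_left_mono powr_mono) auto
      ultimately have "symbol_series a \<alpha> z \<le> (B + E) * z" using False by (simp add: distrib_right)
      also have "\<dots> \<le> (B + E) * (1 + z)" using \<open>B \<ge> 0\<close> \<open>E \<ge> 0\<close> by (intro mult_left_mono) auto
      finally show ?thesis .
    qed
  qed
qed

text \<open>For \<open>\<alpha> = 2\<close> the equation reads
  \<open>(z F)' = a / z - a G / z\<close>. The first term gives the logarithm with the sharp
  constant \<open>a\<close>, which fixes the gain at \<open>\<beta> = n\<close>; the second must
  contribute only a bounded amount.\<close>

lemma symbol_series_log_lower_bound:
  assumes a: "a \<ge> 1 / 2"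
  obtains C where "\<And>z. z \<ge> 1 \<Longrightarrow> z * symbol_series a 2 z \<ge> a * ln z - C"
proof -
  have a0: "a > 0" using a by simp
  have "(2::real) > 0" by simp
  from symbol_series_has_derivative[OF a0 this]
  obtain D where D: "\<And>z. (symbol_series a 2 has_field_derivative D z) (at z)"
    and "\<And>z. z * (z * D z + (2 - 1) * symbol_series a 2 z) = (2 - 1) * a * (1 - bessel a z)"
    by metis
  then have ode: "\<And>z. z * (z * D z + symbol_series a 2 z) = a * (1 - bessel a z)" by simp
  \<comment> \<open>\<open>G / z\<close> is not absolutely integrable; adding \<open>bessel (a + 1) z = - a G'\<close> cancels it.\<close>
  let ?Y = "\<lambda>z. z * symbol_series a 2 z - a * ln z + bessel (a + 1) z - 2 * a\<^sup>2 * z powr (- 1 / 2)"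
  show ?thesis
  proof (rule that[of "1 - ?Y 1"])
    fix z :: real assume z: "z \<ge> 1"
    have "?Y 1 \<le> ?Y z"
    proof (rule DERIV_nonneg_imp_nondecreasing[OF z])
      fix x :: real assume x: "1 \<le> x" "x \<le> z"
      define b2 where "b2 = bessel (a + 2) x"
      have d2: "(bessel (a + 1) has_field_derivative - b2 / (a + 1)) (at x)"
        using bessel_has_derivative[of "a + 1"] a by (simp add: b2_def add.assoc)
      have "x * b2 / (a * (a + 1)) = bessel (a + 1) x - bessel a x"
        using bessel_recurrence[OF a0, of x] by (simp add: b2_def)
      then have "a * (x * b2 / (a * (a + 1))) = a * (bessel (a + 1) x - bessel a x)" by simp
      then have rec: "x * (b2 / (a + 1)) = a * (bessel (a + 1) x - bessel a x)" using a0 by simp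
      have p: "x powr (- 1 / 2 - 1) = x powr (- 1 / 2) / x"
        using x powr_diff[of x "- 1 / 2" 1] by simp
      have deriv: "(?Y has_field_derivative
          (symbol_series a 2 x + x * D x - a / x - b2 / (a + 1) + a\<^sup>2 * x powr (- 1 / 2 - 1))) (at x)"
        using x by (auto intro!: derivative_eq_intros D d2)
      have "symbol_series a 2 x + x * D x - a / x - b2 / (a + 1) + a\<^sup>2 * x powr (- 1 / 2 - 1)
        = (x * (x * D x + symbol_series a 2 x) - a - x * (b2 / (a + 1)) + a\<^sup>2 * x powr (- 1 / 2)) / x"
        unfolding p using x a0 by (simp add: divide_simps)
      \<comment> \<open>The terms in \<open>bessel a x\<close> have cancelled. What is left decays
        like \<open>x powr (- 3 / 2)\<close> and is absorbed by the derivative of the last term of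
        \<open>?Y\<close>.\<close>
      also have "\<dots> = a * (a * x powr (- 1 / 2) - bessel (a + 1) x) / x"
        unfolding ode rec by (simp add: algebra_simps power2_eq_square)
      also have "\<dots> \<ge> 0" using bessel_decay[OF a, of x] x a0 by auto
      also note sign = calculation
      show "\<exists>y. (?Y has_field_derivative y) (at x) \<and> 0 \<le> y" by (rule exI, rule conjI, rule deriv, rule sign)
    qed
    moreover have "2 * a\<^sup>2 * z powr (- 1 / 2) \<ge> 0" by simp
    moreover have "bessel (a + 1) z \<le> 1" using abs_bessel_le_1[of "a + 1" z] a z by auto
    ultimately show "z * symbol_series a 2 z \<ge> a * ln z - (1 - ?Y 1)" by linarith
  qed
qed

text \<open>A positive power dominates every multiple of the logarithm, by
  \<open>ln u \<le> u - 1\<close>.\<close>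

lemma symbol_series_superlog:
  assumes a: "a \<ge> 1 / 2" and \<alpha>: "0 < \<alpha>" "\<alpha> < 2" and "B > 0"
  obtains C where "\<And>z. z \<ge> 1 \<Longrightarrow> z * symbol_series a \<alpha> z \<ge> B * ln z - C"
proof -
  obtain c where c: "c > 0" "\<And>z. z \<ge> 1 \<Longrightarrow> z * symbol_series a \<alpha> z \<ge> c * z powr (2 - \<alpha>)"
    using symbol_series_lower_bound[OF a \<alpha>(1)] by metis
  define \<gamma> where "\<gamma> = 2 - \<alpha>"
  \<comment> \<open>Chosen so that \<open>B / \<gamma> * e = c\<close>, the constant of the power
    bound.\<close>
  define e where "e = c * \<gamma> / B"
  have \<gamma>: "\<gamma> > 0" using \<alpha> by (simp add: \<gamma>_def)
  have e: "e > 0" using c \<gamma> \<open>B > 0\<close> by (simp add: e_def)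
  show ?thesis
  proof (rule that[of "- (B / \<gamma> * ln e)"])
    fix z :: real assume z: "z \<ge> 1"
    have "ln (e * z powr \<gamma>) \<le> e * z powr \<gamma>" using ln_le_minus_one[of "e * z powr \<gamma>"] e z by simp
    moreover have "ln (e * z powr \<gamma>) = ln e + \<gamma> * ln z" using e z by (simp add: ln_mult ln_powr)
    ultimately have "B / \<gamma> * (ln e + \<gamma> * ln z) \<le> B / \<gamma> * (e * z powr \<gamma>)"
      using \<open>B > 0\<close> \<gamma> by (intro mult_left_mono) auto
    also have "B / \<gamma> * (e * z powr \<gamma>) = c * z powr \<gamma>"
      using \<gamma> \<open>B > 0\<close> by (simp add: e_def)
    also have "\<dots> \<le> z * symbol_series a \<alpha> z" using c(2)[OF z] by (simp add: \<gamma>_def)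
    finally show "z * symbol_series a \<alpha> z \<ge> B * ln z - - (B / \<gamma> * ln e)"
      using \<gamma> by (simp add: distrib_left)
  qed
qed

section \<open>The bounds in terms of the multiplier\<close>

lemma multiplier_conv_symbol_series:
  "multiplier \<delta> \<beta> (\<nu> :: real ^ 'n) = - (norm \<nu>)\<^sup>2 *
     symbol_series (real CARD('n) / 2) ((real CARD('n) + 4 - \<beta>) / 2) ((norm \<nu>)\<^sup>2 * \<delta>\<^sup>2 / 4)"
proof -
  have "hypergeometric [1, \<alpha> - 1] [2, a + 1, \<alpha>] (- z) = symbol_series a \<alpha> z" for a \<alpha> z
    unfolding hypergeometric_def symbol_series_def symbol_fps_def eval_fps_def
    by (simp add: power_minus[of z] mult_ac)
  from this[of "(real CARD('n) + 4 - \<beta>) / 2" "real CARD('n) / 2" "(norm \<nu>)\<^sup>2 * \<delta>\<^sup>2 / 4"]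
  show ?thesis unfolding multiplier_def Let_def by (simp add: field_simps)
qed

text \<open>The dimension is at least 1, which is what the energy estimate asks of
  \<open>a = n / 2\<close>.\<close>

lemma half_card_ge: "real CARD('n::finite) / 2 \<ge> 1 / 2"
  by (simp add: Suc_le_eq)

lemma multiplier_nonpos:
  fixes \<nu> :: "real ^ 'n"
  assumes "\<beta> < real CARD('n) + 4"
  shows "multiplier \<delta> \<beta> \<nu> \<le> 0"
  unfolding multiplier_conv_symbol_series
  using assms by (auto intro!: mult_nonneg_nonneg symbol_series_nonneg half_card_ge)

lemma multiplier_lower_bound:
  assumes "\<beta> < real CARD('n) + 4"
  obtains C where "C \<ge> 0" and "\<And>\<nu> :: real ^ 'n. - multiplier \<delta> \<beta> \<nu> \<le> C * (1 + (norm \<nu>)\<^sup>2) ^ 2"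
proof -
  define a \<alpha> where "a = real CARD('n) / 2" and "\<alpha> = (real CARD('n) + 4 - \<beta>) / 2"
  have a: "a \<ge> 1 / 2" unfolding a_def by (rule half_card_ge)
  have \<alpha>: "\<alpha> > 0" using assms by (simp add: \<alpha>_def)
  obtain C where C: "\<And>z. z \<ge> 0 \<Longrightarrow> symbol_series a \<alpha> z \<le> C * (1 + z)"
    using symbol_series_upper_bound[OF a \<alpha>] by metis
  have "C \<ge> 0" using C[of 0] by simp
  show ?thesis
  proof (rule that[of "C * (1 + \<delta>\<^sup>2 / 4)"])
    show "C * (1 + \<delta>\<^sup>2 / 4) \<ge> 0" using \<open>C \<ge> 0\<close> by simp
    fix \<nu> :: "real ^ 'n"
    define y where "y = (norm \<nu>)\<^sup>2"
    have y: "y \<ge> 0" by (simp add: y_def)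
    have "- multiplier \<delta> \<beta> \<nu> = y * symbol_series a \<alpha> (y * \<delta>\<^sup>2 / 4)"
      by (simp add: multiplier_conv_symbol_series y_def a_def \<alpha>_def)
    also have "\<dots> \<le> y * (C * (1 + y * \<delta>\<^sup>2 / 4))" using C[of "y * \<delta>\<^sup>2 / 4"] y by (intro mult_left_mono) auto
    also have "\<dots> \<le> (1 + y) * (C * ((1 + \<delta>\<^sup>2 / 4) * (1 + y)))"
      using y \<open>C \<ge> 0\<close> by (intro mult_mono mult_left_mono) (auto simp: distrib_left distrib_right)
    finally show "- multiplier \<delta> \<beta> \<nu> \<le> C * (1 + \<delta>\<^sup>2 / 4) * (1 + (norm \<nu>)\<^sup>2) ^ 2"
      by (simp add: y_def power2_eq_square mult_ac)
  qed
qed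

text \<open>The factor \<open>4 / \<delta>\<^sup>2\<close> is the ratio of the squared norm of \<nu>
  to \<open>z\<close>. Passing from \<open>ln z\<close> to the logarithm of the weight costs a
  constant, and for \<open>z < 1\<close> that logarithm is bounded and
  \<open>multiplier_nonpos\<close> suffices.\<close>

lemma multiplier_log_bound_if_series:
  fixes \<delta> \<beta> B :: real
  defines "a \<equiv> real CARD('n) / 2" and "\<alpha> \<equiv> (real CARD('n) + 4 - \<beta>) / 2"
  assumes \<beta>: "\<beta> < real CARD('n) + 4" and \<delta>: "\<delta> > 0" and B: "B \<ge> 0"
    and C: "\<And>z. z \<ge> 1 \<Longrightarrow> z * symbol_series a \<alpha> z \<ge> B * ln z - C"
  shows "\<exists>K. \<forall>\<nu> :: real ^ 'n. multiplier \<delta> \<beta> \<nu> \<le> K - 4 * B / \<delta>\<^sup>2 * ln (1 + (norm \<nu>)\<^sup>2)"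
proof (intro exI allI)
  fix \<nu> :: "real ^ 'n"
  define y z L where "y = (norm \<nu>)\<^sup>2" and "z = y * \<delta>\<^sup>2 / 4" and "L = ln (1 + 4 / \<delta>\<^sup>2)"
  have y: "y \<ge> 0" by (simp add: y_def)
  have d4: "1 + 4 / \<delta>\<^sup>2 \<ge> 1" by simp
  have yz: "y = 4 / \<delta>\<^sup>2 * z" using \<delta> by (simp add: z_def)
  have BL: "4 * B / \<delta>\<^sup>2 * L \<ge> 0" using B d4 unfolding L_def by (intro mult_nonneg_nonneg ln_ge_zero) auto
  show "multiplier \<delta> \<beta> \<nu> \<le> (4 * \<bar>C\<bar> / \<delta>\<^sup>2 + 4 * B / \<delta>\<^sup>2 * L) - 4 * B / \<delta>\<^sup>2 * ln (1 + (norm \<nu>)\<^sup>2)"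
  proof (cases "z \<ge> 1")
    case True
    have "multiplier \<delta> \<beta> \<nu> = - (4 / \<delta>\<^sup>2) * (z * symbol_series a \<alpha> z)"
      unfolding multiplier_conv_symbol_series a_def \<alpha>_def z_def y_def using \<delta> by simp
    also have "\<dots> \<le> - (4 / \<delta>\<^sup>2) * (B * ln z - C)"
      using C[OF True] by (intro mult_left_mono_neg) auto
    also have "\<dots> = 4 * C / \<delta>\<^sup>2 - 4 * B / \<delta>\<^sup>2 * ln z" by (simp add: right_diff_distrib diff_divide_distrib mult_ac)
    finally have 1: "multiplier \<delta> \<beta> \<nu> \<le> 4 * C / \<delta>\<^sup>2 - 4 * B / \<delta>\<^sup>2 * ln z" .
    have "1 + y \<le> (1 + 4 / \<delta>\<^sup>2) * z" using True unfolding yz by (simp add: distrib_right)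
    then have "ln (1 + y) \<le> ln ((1 + 4 / \<delta>\<^sup>2) * z)" using y by (intro ln_mono) auto
    also have "\<dots> = L + ln z" using True unfolding L_def by (intro ln_mult_pos add_pos_nonneg) auto
    finally have "4 * B / \<delta>\<^sup>2 * ln (1 + y) \<le> 4 * B / \<delta>\<^sup>2 * (L + ln z)"
      using B by (intro mult_left_mono) auto
    moreover have "4 * C / \<delta>\<^sup>2 \<le> 4 * \<bar>C\<bar> / \<delta>\<^sup>2" by (intro divide_right_mono) auto
    ultimately show ?thesis using 1 by (simp add: y_def[symmetric] distrib_left)
  next
    case False
    have "4 / \<delta>\<^sup>2 * z \<le> 4 / \<delta>\<^sup>2 * 1" using False by (intro mult_left_mono) auto
    then have "ln (1 + y) \<le> L" unfolding L_def using yz y by (intro ln_mono) auto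
    then have "4 * B / \<delta>\<^sup>2 * ln (1 + y) \<le> 4 * B / \<delta>\<^sup>2 * L" using B by (intro mult_left_mono) auto
    moreover have "multiplier \<delta> \<beta> \<nu> \<le> 0" using \<beta> by (rule multiplier_nonpos)
    moreover have "4 * \<bar>C\<bar> / \<delta>\<^sup>2 \<ge> 0" by simp
    ultimately show ?thesis unfolding y_def[symmetric] by linarith
  qed
qed

lemma multiplier_le_log:
  assumes "\<delta> > 0"
  shows "\<exists>K. \<forall>\<nu> :: real ^ 'n. multiplier \<delta> (real CARD('n)) \<nu>
    \<le> K - 2 * real CARD('n) / \<delta>\<^sup>2 * ln (1 + (norm \<nu>)\<^sup>2)"
proof -
  define a where "a = real CARD('n) / 2"
  have a: "a \<ge> 1 / 2" unfolding a_def by (rule half_card_ge)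
  obtain C where C: "\<And>z. z \<ge> 1 \<Longrightarrow> z * symbol_series a 2 z \<ge> a * ln z - C"
    using symbol_series_log_lower_bound[OF a] by metis
  have "\<exists>K. \<forall>\<nu> :: real ^ 'n. multiplier \<delta> (real CARD('n)) \<nu> \<le> K - 4 * a / \<delta>\<^sup>2 * ln (1 + (norm \<nu>)\<^sup>2)"
    using C a assms by (intro multiplier_log_bound_if_series) (auto simp: a_def)
  then show ?thesis by (simp add: a_def)
qed

text \<open>Here \<open>\<alpha> < 2\<close>, so the logarithmic factor may be arbitrarily large;
  this is the source of the infinite order.\<close>

lemma multiplier_superlog:
  assumes "\<delta> > 0" "\<beta> > real CARD('n)" "\<beta> < real CARD('n) + 4" "M > 0"
  shows "\<exists>K. \<forall>\<nu> :: real ^ 'n. multiplier \<delta> \<beta> \<nu> \<le> K - M * ln (1 + (norm \<nu>)\<^sup>2)"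
proof -
  define a \<alpha> where "a = real CARD('n) / 2" and "\<alpha> = (real CARD('n) + 4 - \<beta>) / 2"
  have a: "a \<ge> 1 / 2" unfolding a_def by (rule half_card_ge)
  have \<alpha>: "0 < \<alpha>" "\<alpha> < 2" using assms by (auto simp: \<alpha>_def)
  define B where "B = M * \<delta>\<^sup>2 / 4"
  have B: "B > 0" using assms by (simp add: B_def)
  obtain C where C: "\<And>z. z \<ge> 1 \<Longrightarrow> z * symbol_series a \<alpha> z \<ge> B * ln z - C"
    using symbol_series_superlog[OF a \<alpha> B] by metis
  have "\<exists>K. \<forall>\<nu> :: real ^ 'n. multiplier \<delta> \<beta> \<nu> \<le> K - 4 * B / \<delta>\<^sup>2 * ln (1 + (norm \<nu>)\<^sup>2)"
    using C B assms by (intro multiplier_log_bound_if_series) (auto simp: a_def \<alpha>_def)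
  then show ?thesis using assms by (simp add: B_def)
qed

section \<open>Test functions and integration by parts on the torus\<close>

text \<open>One level of \<open>smooth\<close>, isolated so that facts can be stated for a single
  function rather than for all its derivatives.\<close>

definition partially_differentiable :: "(real ^ 'n \<Rightarrow> complex) \<Rightarrow> bool" where
  "partially_differentiable g \<longleftrightarrow> continuous_on UNIV g \<and>
     (\<forall>i x. (\<lambda>h. g (x + h *\<^sub>R axis i 1)) differentiable (at (0::real)))"

text \<open>The definition differentiates at step 0; moving the base point along the axis gives the
  derivative at every step \<open>h\<close>.\<close>

lemma partial_deriv_at:
  fixes g :: "real ^ 'n \<Rightarrow> complex"
  assumes "partially_differentiable g"
  shows "((\<lambda>h. g (x + h *\<^sub>R axis i 1)) has_vector_derivative partial_deriv i g (x + h *\<^sub>R axis i 1)) (at h within A)"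
proof -
  let ?y = "x + h *\<^sub>R axis i 1"
  have "(\<lambda>h. g (?y + h *\<^sub>R axis i 1)) differentiable (at (0::real))"
    using assms by (simp add: partially_differentiable_def)
  then have "((\<lambda>h. g (?y + h *\<^sub>R axis i 1)) has_vector_derivative partial_deriv i g ?y) (at 0)"
    by (simp add: partial_deriv_def vector_derivative_works)
  then have "(((\<lambda>h. g (?y + h *\<^sub>R axis i 1)) \<circ> (\<lambda>u. u - h)) has_vector_derivative
      1 *\<^sub>R partial_deriv i g ?y) (at h)"
    by (intro vector_diff_chain_at) (auto intro!: derivative_eq_intros)
  moreover have "(\<lambda>h. g (?y + h *\<^sub>R axis i 1)) \<circ> (\<lambda>u. u - h) = (\<lambda>u. g (x + u *\<^sub>R axis i 1))"
    by (auto simp: algebra_simps)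
  ultimately show ?thesis by (simp add: has_vector_derivative_at_within)
qed

text \<open>The slab lost at one face of the cell is a translate by one period of the slab gained at
  the opposite face.\<close>

lemma integral_cell_shift:
  fixes g :: "real ^ 'n \<Rightarrow> complex" and r :: "real ^ 'n"
  assumes cont: "continuous_on UNIV g"
    and per: "\<And>x. g (x + (r $ i) *\<^sub>R axis i 1) = g x"
    and r: "\<And>i. r $ i > 0" and h: "0 \<le> h" "h \<le> r $ i"
  shows "integral (cbox 0 r) (\<lambda>x. g (x + h *\<^sub>R axis i 1)) = integral (cbox 0 r) g"
proof -
  let ?e = "axis i 1 :: real ^ 'n"
  have shift: "integral (cbox a b) (\<lambda>x. g (x + c)) = integral (cbox (a + c) (b + c)) g" for a b c
    using integral_shift_cbox_plus[of a b g c] by (simp add: o_def add.commute)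
  have int: "g integrable_on cbox a b" for a b
    using continuous_on_subset[OF cont] by (intro integrable_continuous) auto
  have B: "?e \<in> Basis" by (simp add: axis_in_Basis_iff)
  have split_le: "cbox a b \<inter> {x. x \<bullet> ?e \<le> c} = cbox a (\<chi> j. if j = i then min (b $ i) c else b $ j)" for a b c
    using interval_split_cart(1)[where a = a and b = b and k = i and c = c, unfolded interval_cbox_cart] by (simp add: inner_axis)
  have split_ge: "cbox a b \<inter> {x. x \<bullet> ?e \<ge> c} = cbox (\<chi> j. if j = i then max (a $ i) c else a $ j) b" for a b c
    using interval_split_cart(2)[where a = a and b = b and k = i and c = c, unfolded interval_cbox_cart] by (simp add: inner_axis)
  \<comment> \<open>Corners of the two pieces of the cell cut at height \<open>h\<close> in
    direction \<open>i\<close>. The upper piece is also the part shared with the shifted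
    cell.\<close>
  let ?u = "\<chi> j. if j = i then h else r $ j"
  let ?l = "\<chi> j. if j = i then h else 0"
  have 1: "integral (cbox 0 r) g = integral (cbox 0 ?u) g + integral (cbox ?l r) g"
  proof -
    have "cbox 0 r \<inter> {x. x \<bullet> ?e \<le> h} = cbox 0 ?u"
      unfolding split_le using h by (intro arg_cong2[of _ _ _ _ cbox]) (auto simp: vec_eq_iff)
    moreover have "cbox 0 r \<inter> {x. x \<bullet> ?e \<ge> h} = cbox ?l r"
      unfolding split_ge using h by (intro arg_cong2[of _ _ _ _ cbox]) (auto simp: vec_eq_iff)
    ultimately show ?thesis using integral_split[OF int B, of 0 r h] by simp
  qed
  let ?u' = "r + h *\<^sub>R ?e"
  let ?l' = "\<chi> j. if j = i then r $ i else 0"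
  have 2: "integral (cbox (h *\<^sub>R ?e) ?u') g = integral (cbox ?l r) g + integral (cbox ?l' ?u') g"
  proof -
    have "cbox (h *\<^sub>R ?e) ?u' \<inter> {x. x \<bullet> ?e \<le> r $ i} = cbox ?l r"
      unfolding split_le using h by (intro arg_cong2[of _ _ _ _ cbox]) (auto simp: vec_eq_iff axis_def)
    moreover have "cbox (h *\<^sub>R ?e) ?u' \<inter> {x. x \<bullet> ?e \<ge> r $ i} = cbox ?l' ?u'"
      unfolding split_ge using h by (intro arg_cong2[of _ _ _ _ cbox]) (auto simp: vec_eq_iff axis_def)
    ultimately show ?thesis using integral_split[OF int B, of "h *\<^sub>R ?e" ?u' "r $ i"] by simp
  qed
  have "integral (cbox 0 ?u) g = integral (cbox 0 ?u) (\<lambda>x. g (x + (r $ i) *\<^sub>R ?e))"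
    by (simp add: per)
  also have "\<dots> = integral (cbox (0 + (r $ i) *\<^sub>R ?e) (?u + (r $ i) *\<^sub>R ?e)) g" by (rule shift)
  also have "0 + (r $ i) *\<^sub>R ?e = ?l'" by (simp add: vec_eq_iff axis_def)
  also have "?u + (r $ i) *\<^sub>R ?e = ?u'" by (simp add: vec_eq_iff axis_def)
  finally have 3: "integral (cbox 0 ?u) g = integral (cbox ?l' ?u') g" .
  have "integral (cbox 0 r) (\<lambda>x. g (x + h *\<^sub>R ?e)) = integral (cbox (h *\<^sub>R ?e) ?u') g"
    using shift[of 0 r "h *\<^sub>R ?e"] by simp
  then show ?thesis using 1 2 3 by simp
qed

text \<open>Differentiate the translation-invariant integral over the cell under the integral sign.\<close>

lemma integral_cell_partial_deriv:
  fixes g :: "real ^ 'n \<Rightarrow> complex" and r :: "real ^ 'n"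
  assumes g: "partially_differentiable g" and cont: "continuous_on UNIV (partial_deriv i g)"
    and per: "\<And>x. g (x + (r $ i) *\<^sub>R axis i 1) = g x"
    and r: "\<And>i. r $ i > 0"
  shows "integral (cbox 0 r) (partial_deriv i g) = 0"
proof -
  let ?e = "axis i 1 :: real ^ 'n"
  let ?I = "\<lambda>h. integral (cbox 0 r) (\<lambda>x. g (x + h *\<^sub>R ?e))"
  have cg: "continuous_on UNIV g" using g by (simp add: partially_differentiable_def)
  \<comment> \<open>The derivative at 0 is one-sided, matching the range of shifts for which
    \<open>?I\<close> is known to be constant; it is unique because the interval is
    nondegenerate.\<close>
  have "(?I has_vector_derivative integral (cbox 0 r) (\<lambda>x. partial_deriv i g (x + 0 *\<^sub>R ?e)))
    (at 0 within {0..r $ i})"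
  proof (rule leibniz_rule_vector_derivative)
    show "((\<lambda>h. g (x + h *\<^sub>R ?e)) has_vector_derivative partial_deriv i g (x + h *\<^sub>R ?e))
      (at h within {0..r $ i})" for h x
      using g by (rule partial_deriv_at)
    show "(\<lambda>x. g (x + h *\<^sub>R ?e)) integrable_on cbox 0 r" for h
      by (intro integrable_continuous continuous_on_compose2[OF cg]) (auto intro!: continuous_intros)
    show "continuous_on ({0..r $ i} \<times> cbox 0 r) (\<lambda>(h, x). partial_deriv i g (x + h *\<^sub>R ?e))"
      unfolding split_beta
      by (intro continuous_on_compose2[OF cont]) (auto intro!: continuous_intros)
  qed (use r[of i] in auto)
  then have "(?I has_vector_derivative integral (cbox 0 r) (partial_deriv i g)) (at 0 within {0..r $ i})"
    by simp
  moreover have "(?I has_vector_derivative 0) (at 0 within {0..r $ i})"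
  proof (rule has_vector_derivative_transform)
    show "((\<lambda>h. integral (cbox 0 r) g) has_vector_derivative 0) (at 0 within {0..r $ i})"
      by (rule has_vector_derivative_const)
    show "0 \<in> {0..r $ i}" using r[of i] by simp
    show "?I h = integral (cbox 0 r) g" if "h \<in> {0..r $ i}" for h
      using integral_cell_shift[OF cg per r] that by simp
  qed
  ultimately show ?thesis
    using vector_derivative_unique_within_closed_interval[of 0 "r $ i" 0 ?I] r[of i] by simp
qed

section \<open>Iterated derivatives and boundedness of test functions\<close>

lemma iter_partial_Nil [simp]: "iter_partial [] \<phi> = \<phi>"
  by (simp add: iter_partial_def)

lemma iter_partial_Cons [simp]: "iter_partial (i # is) \<phi> = partial_deriv i (iter_partial is \<phi>)"
  by (simp add: iter_partial_def)

lemma iter_partial_append: "iter_partial (is @ js) \<phi> = iter_partial is (iter_partial js \<phi>)"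
  by (simp add: iter_partial_def)

lemma smooth_iff: "smooth \<phi> \<longleftrightarrow> (\<forall>is. partially_differentiable (iter_partial is \<phi>))"
  by (auto simp: smooth_def partially_differentiable_def)

lemma partial_deriv_test_function:
  assumes "\<phi> \<in> test_functions r" shows "partial_deriv i \<phi> \<in> test_functions r"
proof -
  have "iter_partial is (partial_deriv i \<phi>) = iter_partial (is @ [i]) \<phi>" for "is"
    by (simp add: iter_partial_append)
  then have "smooth (partial_deriv i \<phi>)" using assms by (simp add: test_functions_def smooth_iff)
  moreover have "partial_deriv i \<phi> (x + (r $ j) *\<^sub>R axis j 1) = partial_deriv i \<phi> x" for x j
  proof -
    have "\<phi> (x + (r $ j) *\<^sub>R axis j 1 + h *\<^sub>R axis i 1) = \<phi> (x + h *\<^sub>R axis i 1)" for h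
    proof -
      have "\<phi> (x + h *\<^sub>R axis i 1 + (r $ j) *\<^sub>R axis j 1) = \<phi> (x + h *\<^sub>R axis i 1)"
        using assms by (simp add: test_functions_def)
      then show ?thesis by (simp add: add_ac)
    qed
    then show ?thesis by (simp add: partial_deriv_def)
  qed
  ultimately show ?thesis by (simp add: test_functions_def)
qed

lemma iter_partial_test_function:
  assumes "\<phi> \<in> test_functions r" shows "iter_partial is \<phi> \<in> test_functions r"
  by (induction "is") (auto simp: assms partial_deriv_test_function)

lemma test_functionD:
  assumes "\<phi> \<in> test_functions r"
  shows "partially_differentiable \<phi>" "continuous_on UNIV \<phi>" "\<phi> (x + (r $ i) *\<^sub>R axis i 1) = \<phi> x"
proof -
  have "\<forall>is. partially_differentiable (iter_partial is \<phi>)"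
    using assms by (simp add: test_functions_def smooth_iff)
  from spec[OF this, of "[]"] show 1: "partially_differentiable \<phi>" by simp
  show "continuous_on UNIV \<phi>" using 1 by (simp add: partially_differentiable_def)
  show "\<phi> (x + (r $ i) *\<^sub>R axis i 1) = \<phi> x" using assms by (simp add: test_functions_def)
qed

text \<open>Subtracting \<open>\<lfloor>y $ i / r $ i\<rfloor>\<close> periods brings coordinate
  \<open>i\<close> into range and leaves the others alone, so induction over the set of treated
  coordinates works.\<close>

lemma periodic_reduce:
  fixes g :: "real ^ 'n \<Rightarrow> complex"
  assumes per: "\<And>x i. g (x + (r $ i) *\<^sub>R axis i 1) = g x" and r: "\<And>i. r $ i > 0"
  obtains y where "y \<in> cbox 0 r" "g y = g x"
proof -
  have nat: "g (x + (real n * r $ i) *\<^sub>R axis i 1) = g x" for x i n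
  proof (induction n)
    case (Suc n)
    have "g (x + (real (Suc n) * r $ i) *\<^sub>R axis i 1) = g (x + (real n * r $ i) *\<^sub>R axis i 1 + (r $ i) *\<^sub>R axis i 1)"
      by (simp add: algebra_simps)
    then show ?case using per Suc by simp
  qed simp
  have int: "g (x + (of_int m * r $ i) *\<^sub>R axis i 1) = g x" for x i m
  proof (cases "m \<ge> 0")
    case True
    then show ?thesis using nat[of x "nat m" i] by simp
  next
    case False
    then show ?thesis using nat[of "x + (of_int m * r $ i) *\<^sub>R axis i 1" "nat (- m)" i]
      by (simp add: algebra_simps)
  qed
  have "\<exists>y. g y = g x \<and> (\<forall>i\<in>S. 0 \<le> y $ i \<and> y $ i \<le> r $ i)" if "finite S" for S
    using that
  proof (induction S)
    case (insert i S)
    then obtain y where y: "g y = g x" "\<And>j. j \<in> S \<Longrightarrow> 0 \<le> y $ j \<and> y $ j \<le> r $ j" by auto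
    define m where "m = \<lfloor>y $ i / r $ i\<rfloor>"
    have m: "of_int m * r $ i \<le> y $ i" "y $ i < (of_int m + 1) * r $ i"
      using floor_divide_lower[of "r $ i" "y $ i"] floor_divide_upper[of "r $ i" "y $ i"] r[of i] by (auto simp: m_def)
    show ?case
    proof (intro exI conjI ballI)
      let ?y = "y + (of_int (- m) * r $ i) *\<^sub>R axis i 1"
      show "g ?y = g x" using int[of y "- m" i] y(1) by simp
      fix j assume "j \<in> insert i S"
      then show "0 \<le> ?y $ j" "?y $ j \<le> r $ j"
        using y(2)[of j] m insert.hyps by (auto simp: axis_def algebra_simps)
    qed
  qed auto
  from this[of UNIV] show ?thesis using that by (auto simp: mem_box_cart)
qed

lemma test_function_bounded:
  assumes "\<phi> \<in> test_functions r" and r: "\<And>i. r $ i > 0"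
  shows "\<exists>B. \<forall>x. cmod (\<phi> x) \<le> B"
proof -
  have "bounded (\<phi> ` cbox 0 r)"
    using test_functionD(2)[OF assms(1)]
    by (intro compact_imp_bounded compact_continuous_image) (auto intro: continuous_on_subset)
  then obtain B where B: "\<And>x. x \<in> cbox 0 r \<Longrightarrow> cmod (\<phi> x) \<le> B" by (auto simp: bounded_iff)
  show ?thesis
  proof (intro exI allI)
    fix x
    obtain y where "y \<in> cbox 0 r" "\<phi> y = \<phi> x"
      using periodic_reduce[of \<phi> r x] test_functionD(3)[OF assms(1)] r by metis
    then show "cmod (\<phi> x) \<le> B" using B[of y] by simp
  qed
qed

text \<open>A real supremum is an upper bound only of a bounded set. Boundedness holds because there
  are finitely many index lists of length at most \<open>N\<close> and each derivative is periodic
  and continuous.\<close>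

lemma iter_partial_le_Ck_norm:
  fixes \<phi> :: "real ^ 'n \<Rightarrow> complex"
  assumes "\<phi> \<in> test_functions r" and r: "\<And>i. r $ i > 0" and "length is \<le> N"
  shows "cmod (iter_partial is \<phi> x) \<le> Ck_norm N \<phi>"
proof -
  let ?L = "{is :: 'n list. length is \<le> N}"
  have "\<forall>is. \<exists>B. \<forall>x. cmod (iter_partial is \<phi> x) \<le> B"
    using test_function_bounded[OF iter_partial_test_function[OF assms(1)] r] by blast
  then obtain B where B: "\<And>is x. cmod (iter_partial is \<phi> x) \<le> B is" by metis
  have fin: "finite ?L" using finite_lists_length_le[of "UNIV :: 'n set" N] by simp
  have "cmod (iter_partial is \<phi> x) \<le> Max (B ` ?L)" if "is \<in> ?L" for "is" x
    by (rule order_trans[OF B Max_ge]) (use fin that in auto)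
  then have "bdd_above ((\<lambda>(is, x). cmod (iter_partial is \<phi> x)) ` (?L \<times> UNIV))"
    by (intro bdd_aboveI[of _ "Max (B ` ?L)"]) auto
  from cSUP_upper[OF _ this, of "(is, x)"] show ?thesis
    using assms(3) by (simp add: Ck_norm_def)
qed

section \<open>Exponentials and their integrals over the cell\<close>

lemma freq_component_period:
  assumes "r $ i > 0" shows "freq r k $ i * r $ i = 2 * pi * of_int (k $ i)"
  using assms by (simp add: freq_def)

text \<open>The constant \<open>c\<close> keeps this class of functions closed under partial
  derivatives, as the induction over index lists requires.\<close>

lemma wave_has_derivative:
  "((\<lambda>h. c * cis (v \<bullet> (x + h *\<^sub>R axis i 1))) has_vector_derivative
     c * \<i> * of_real (v $ i) * cis (v \<bullet> (x + t *\<^sub>R axis i 1))) (at t)"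
proof -
  have "((\<lambda>h. c * exp (\<i> * (of_real (v \<bullet> x) + of_real h * of_real (v $ i)))) has_vector_derivative
     c * \<i> * of_real (v $ i) * exp (\<i> * (of_real (v \<bullet> x) + of_real t * of_real (v $ i)))) (at t)"
    by (rule has_vector_derivative_real_field[where f = "\<lambda>w. c * exp (\<i> * (of_real (v \<bullet> x) + w * of_real (v $ i)))"])
      (auto intro!: derivative_eq_intros)
  moreover have "exp (\<i> * (of_real (v \<bullet> x) + of_real h * of_real (v $ i))) = cis (v \<bullet> (x + h *\<^sub>R axis i 1))" for h
    by (simp add: cis_conv_exp inner_add_right inner_axis)
  ultimately show ?thesis by simp
qed

lemma partial_deriv_wave:
  "partial_deriv i (\<lambda>x. c * cis (v \<bullet> x)) = (\<lambda>x. (c * \<i> * of_real (v $ i)) * cis (v \<bullet> x))"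
proof
  fix x
  show "partial_deriv i (\<lambda>x. c * cis (v \<bullet> x)) x = (c * \<i> * of_real (v $ i)) * cis (v \<bullet> x)"
    using vector_derivative_at[OF wave_has_derivative[of c v x i 0]] by (simp add: partial_deriv_def)
qed

lemma continuous_on_wave: "continuous_on A (\<lambda>x. c * cis (v \<bullet> x))"
  by (intro continuous_intros)

lemma partially_differentiable_wave: "partially_differentiable (\<lambda>x. c * cis (v \<bullet> x))"
  unfolding partially_differentiable_def
  using continuous_on_wave wave_has_derivative[of c v _ _ 0] by (blast intro: differentiableI_vector)

lemma wave_test_function:
  fixes r :: "real ^ 'n"
  assumes "\<And>i. \<exists>m::int. v $ i * r $ i = 2 * pi * of_int m"
  shows "(\<lambda>x. cis (v \<bullet> x)) \<in> test_functions r"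
proof -
  have "\<exists>c. iter_partial is (\<lambda>x. 1 * cis (v \<bullet> x)) = (\<lambda>x. c * cis (v \<bullet> x))" for "is"
  proof (induction "is")
    case Nil
    show ?case by (rule exI[of _ 1]) simp
  next
    case (Cons i "is")
    then show ?case using partial_deriv_wave by fastforce
  qed
  then have "smooth (\<lambda>x. 1 * cis (v \<bullet> x))"
    unfolding smooth_iff by (metis partially_differentiable_wave)
  moreover have "cis (v \<bullet> (x + (r $ i) *\<^sub>R axis i 1)) = cis (v \<bullet> x)" for x i
  proof -
    obtain m :: int where m: "v $ i * r $ i = 2 * pi * of_int m" using assms by blast
    have "cis (v \<bullet> (x + (r $ i) *\<^sub>R axis i 1)) = cis (v \<bullet> x) * cis (v $ i * r $ i)"
      by (simp add: inner_add_right inner_axis cis_mult mult.commute)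
    also have "cis (v $ i * r $ i) = 1" unfolding m by (rule cis_multiple_2pi) simp
    finally show ?thesis by simp
  qed
  ultimately show ?thesis by (simp add: test_functions_def)
qed

lemma exponential_test_function:
  fixes r :: "real ^ 'n"
  assumes "\<And>i. r $ i > 0"
  shows "(\<lambda>x. cis (freq r k \<bullet> x)) \<in> test_functions r"
  using freq_component_period[OF assms] by (intro wave_test_function) blast

lemma freq_diff: "freq r (k - l) = freq r k - freq r l"
  by (simp add: vec_eq_iff freq_def diff_divide_distrib right_diff_distrib)

text \<open>For \<open>k \<noteq> 0\<close> the exponential is, up to a nonzero factor, its own
  partial derivative in some direction, and such derivatives have integral zero over the
  cell.\<close>

lemma integral_exponential:
  fixes r :: "real ^ 'n"
  assumes r: "\<And>i. r $ i > 0"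
  shows "integral (cbox 0 r) (\<lambda>x. cis (freq r k \<bullet> x)) = (if k = 0 then of_real (\<Prod>i\<in>UNIV. r $ i) else 0)"
proof (cases "k = 0")
  case True
  have "measure lborel (cbox 0 r) = (\<Prod>i\<in>UNIV. r $ i)"
  proof -
    have "0 \<in> cbox 0 r" using r by (simp add: mem_box_cart less_imp_le)
    then have "cbox 0 r \<noteq> {}" by blast
    then show ?thesis by (simp add: content_cbox_if_cart)
  qed
  moreover have "freq r k = 0" using True by (simp add: vec_eq_iff freq_def)
  ultimately show ?thesis using True by (simp add: scaleR_conv_of_real)
next
  case False
  then obtain i where i: "k $ i \<noteq> 0" by (auto simp: vec_eq_iff)
  let ?c = "\<i> * of_real (freq r k $ i)"
  have 1: "(\<lambda>x. 1 * cis (freq r k \<bullet> x)) \<in> test_functions r"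
    using exponential_test_function[OF r, of k] by simp
  have "integral (cbox 0 r) (partial_deriv i (\<lambda>x. 1 * cis (freq r k \<bullet> x))) = 0"
    using 1 r by (intro integral_cell_partial_deriv test_functionD(3)[OF 1] test_functionD(1)[OF 1]
        test_functionD(2)[OF partial_deriv_test_function])
  then have "?c * integral (cbox 0 r) (\<lambda>x. cis (freq r k \<bullet> x)) = 0"
    unfolding partial_deriv_wave by simp
  moreover have "?c \<noteq> 0" using i r[of i] by (simp add: freq_def)
  ultimately show ?thesis using False by simp
qed

lemma exp_distribution_exponential:
  fixes r :: "real ^ 'n"
  assumes r: "\<And>i. r $ i > 0"
  shows "exp_distribution r j (\<lambda>x. cis (- (freq r k \<bullet> x))) = (if j = k then of_real (\<Prod>i\<in>UNIV. r $ i) else 0)"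
proof -
  have "cis (freq r j \<bullet> x) * cis (- (freq r k \<bullet> x)) = cis (freq r (j - k) \<bullet> x)" for x
    by (simp add: cis_mult freq_diff inner_diff_left)
  then show ?thesis using integral_exponential[OF r, of "j - k"] by (simp add: exp_distribution_def)
qed

text \<open>Integration by parts; the boundary terms vanish because the product of the exponential
  and \<phi> is periodic.\<close>

lemma exp_distribution_partial_deriv:
  fixes r :: "real ^ 'n"
  assumes r: "\<And>i. r $ i > 0" and \<phi>: "\<phi> \<in> test_functions r"
  shows "exp_distribution r k (partial_deriv i \<phi>) = - \<i> * of_real (freq r k $ i) * exp_distribution r k \<phi>"
proof -
  define v where "v = freq r k"
  define c where "c = \<i> * of_real (v $ i)"
  let ?g = "\<lambda>x. cis (v \<bullet> x) * \<phi> x"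
  note p\<phi> = test_functionD(1)[OF \<phi>] and c\<phi> = test_functionD(2)[OF \<phi>]
  note cd = test_functionD(2)[OF partial_deriv_test_function[OF \<phi>]]
  have deriv: "((\<lambda>h. ?g (x + h *\<^sub>R axis j 1)) has_vector_derivative
      cis (v \<bullet> x) * partial_deriv j \<phi> x + \<i> * of_real (v $ j) * cis (v \<bullet> x) * \<phi> x) (at 0)" for x j
    using has_vector_derivative_mult[OF wave_has_derivative[of 1 v x j 0] partial_deriv_at[OF p\<phi>, of x j 0 UNIV]]
    by simp
  have pd: "partial_deriv i ?g = (\<lambda>x. cis (v \<bullet> x) * partial_deriv i \<phi> x + c * (cis (v \<bullet> x) * \<phi> x))"
    using vector_derivative_at[OF deriv] by (auto simp: partial_deriv_def c_def mult_ac)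
  have cg: "continuous_on A ?g" for A
    by (intro continuous_intros continuous_on_subset[OF c\<phi>]) auto
  have cw: "continuous_on A (\<lambda>x. cis (v \<bullet> x) * partial_deriv i \<phi> x)" for A
    by (intro continuous_intros continuous_on_subset[OF cd]) auto
  have "integral (cbox 0 r) (partial_deriv i ?g) = 0"
  proof (rule integral_cell_partial_deriv)
    show "partially_differentiable ?g"
      using cg deriv by (auto simp: partially_differentiable_def intro!: differentiableI_vector)
    show "continuous_on UNIV (partial_deriv i ?g)"
      unfolding pd by (intro continuous_on_add cw continuous_on_mult_left cg)
    show "?g (x + (r $ i) *\<^sub>R axis i 1) = ?g x" for x
      using test_functionD(3)[OF \<phi>] test_functionD(3)[OF exponential_test_function[OF r, of k]]
      by (simp add: v_def)
  qed (rule r)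
  also have "integral (cbox 0 r) (partial_deriv i ?g) =
      integral (cbox 0 r) (\<lambda>x. cis (v \<bullet> x) * partial_deriv i \<phi> x) + c * integral (cbox 0 r) ?g"
    unfolding pd using cw cg by (subst integral_add) (auto intro!: integrable_continuous continuous_on_mult_left)
  finally show ?thesis
    unfolding exp_distribution_def v_def[symmetric] c_def by (simp add: add_eq_0_iff2)
qed

section \<open>Rapid decay of the Fourier coefficients of test functions\<close>

definition cell_volume :: "real ^ 'n \<Rightarrow> real" where
  "cell_volume r = measure lborel (cbox 0 r)"

lemma cmod_exp_distribution_le:
  fixes r :: "real ^ 'n"
  assumes \<phi>: "\<phi> \<in> test_functions r" and B: "\<And>x. cmod (\<phi> x) \<le> B"
  shows "cmod (exp_distribution r k \<phi>) \<le> B * cell_volume r"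
  unfolding exp_distribution_def cell_volume_def
proof (rule has_integral_bound)
  show "0 \<le> B" using B[of 0] norm_ge_zero order_trans by blast
  show "((\<lambda>x. cis (freq r k \<bullet> x) * \<phi> x) has_integral integral (cbox 0 r) (\<lambda>x. cis (freq r k \<bullet> x) * \<phi> x)) (cbox 0 r)"
    using continuous_on_subset[OF test_functionD(2)[OF \<phi>]]
    by (intro integrable_integral integrable_continuous continuous_intros) auto
qed (use B in \<open>simp add: norm_mult\<close>)

text \<open>Integrating by parts \<open>N\<close> times in direction \<open>i\<close> trades the
  frequency factor for derivatives of \<phi>.\<close>

lemma exp_distribution_decay_coordinate:
  fixes r :: "real ^ 'n"
  assumes r: "\<And>i. r $ i > 0" and \<phi>: "\<phi> \<in> test_functions r"
  shows "\<bar>freq r k $ i\<bar> ^ N * cmod (exp_distribution r k \<phi>) \<le> cell_volume r * Ck_norm N \<phi>"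
proof -
  have "cmod (exp_distribution r k (iter_partial (replicate m i) \<phi>))
      = \<bar>freq r k $ i\<bar> ^ m * cmod (exp_distribution r k \<phi>)" for m
  proof (induction m)
    case (Suc m)
    then show ?case
      using exp_distribution_partial_deriv[OF r iter_partial_test_function[OF \<phi>]]
      by (simp add: norm_mult)
  qed simp
  moreover have "cmod (exp_distribution r k (iter_partial (replicate N i) \<phi>)) \<le> Ck_norm N \<phi> * cell_volume r"
    by (intro cmod_exp_distribution_le iter_partial_test_function \<phi> iter_partial_le_Ck_norm[OF \<phi> r]) simp
  ultimately show ?thesis by (simp add: mult.commute)
qed

text \<open>The weight of \<open>sobolev\<close>, formed from the index and not from the
  frequency.\<close>

definition lattice_weight :: "int ^ 'n \<Rightarrow> real" where
  "lattice_weight k = 1 + (\<Sum>i\<in>UNIV. (real_of_int (k $ i))\<^sup>2)"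

lemma lattice_weight_ge_1: "lattice_weight k \<ge> 1"
  by (simp add: lattice_weight_def sum_nonneg)

lemma lattice_weight_le_coordinate:
  fixes k :: "int ^ 'n"
  assumes "\<And>i. (real_of_int (k $ i))\<^sup>2 \<le> B" and "B \<ge> 1"
  shows "lattice_weight k \<le> (real CARD('n) + 1) * B"
proof -
  have "(\<Sum>i\<in>UNIV. (real_of_int (k $ i))\<^sup>2) \<le> of_nat CARD('n) * B"
    using assms(1) by (intro sum_bounded_above)
  then show ?thesis using assms(2) by (simp add: lattice_weight_def algebra_simps)
qed

text \<open>The largest coordinate of \<open>k\<close> controls the whole weight, so integrating by
  parts in that one direction is enough. The weight is quadratic, hence \<open>2 * M\<close>
  derivatives.\<close>

lemma exp_distribution_decay:
  fixes r :: "real ^ 'n"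
  assumes r: "\<And>i. r $ i > 0"
  obtains C where "C \<ge> 0" and "\<And>k \<phi>. \<phi> \<in> test_functions r \<Longrightarrow>
    lattice_weight k ^ M * cmod (exp_distribution r k \<phi>) \<le> C * Ck_norm (2 * M) \<phi>"
proof -
  let ?n = "real CARD('n)"
  \<comment> \<open>Dominates the conversion factor from frequency to index in every direction; the
    summand 1 serves the case where all coordinates are at most 1 in absolute value.\<close>
  define S where "S = 1 + (\<Sum>i\<in>UNIV. (r $ i / (2 * pi)) ^ (2 * M))"
  have vol: "cell_volume r \<ge> 0" by (simp add: cell_volume_def)
  have pos: "(r $ i / (2 * pi)) ^ (2 * M) \<ge> 0" for i by simp
  have S1: "S \<ge> 1" using pos by (simp add: S_def sum_nonneg)
  have Si: "(r $ i / (2 * pi)) ^ (2 * M) \<le> S" for i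
    using member_le_sum[of i UNIV "\<lambda>i. (r $ i / (2 * pi)) ^ (2 * M)"] pos by (simp add: S_def)
  show ?thesis
  proof (rule that[of "(?n + 1) ^ M * (S * cell_volume r)"])
    show "(?n + 1) ^ M * (S * cell_volume r) \<ge> 0" using S1 vol by simp
    fix k and \<phi> :: "real ^ 'n \<Rightarrow> complex" assume \<phi>: "\<phi> \<in> test_functions r"
    let ?E = "cmod (exp_distribution r k \<phi>)" and ?N = "Ck_norm (2 * M) \<phi>"
    have N: "?N \<ge> 0" using iter_partial_le_Ck_norm[OF \<phi> r, of "[]" "2 * M" 0]
      by (metis norm_ge_zero order_trans le0 list.size(3))
    obtain i where i: "\<And>j. \<bar>k $ j\<bar> \<le> \<bar>k $ i\<bar>"
    proof -
      have "Max (range (\<lambda>j. \<bar>k $ j\<bar>)) \<in> range (\<lambda>j. \<bar>k $ j\<bar>)" by (rule Max_in) auto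
      then obtain i where "Max (range (\<lambda>j. \<bar>k $ j\<bar>)) = \<bar>k $ i\<bar>" by (rule imageE)
      then show ?thesis using that[of i] by (metis Max_ge finite_class.finite_UNIV finite_imageI rangeI)
    qed
    define B where "B = max 1 ((real_of_int (k $ i))\<^sup>2)"
    have "(real_of_int (k $ j))\<^sup>2 \<le> B" for j
    proof -
      have "\<bar>real_of_int (k $ j)\<bar> \<le> \<bar>real_of_int (k $ i)\<bar>" using i[of j] by linarith
      then show ?thesis by (auto simp: B_def abs_le_square_iff)
    qed
    then have "lattice_weight k \<le> (?n + 1) * B" by (rule lattice_weight_le_coordinate) (simp add: B_def)
    then have "lattice_weight k ^ M \<le> ((?n + 1) * B) ^ M"
      using lattice_weight_ge_1[of k] by (intro power_mono) auto
    then have "lattice_weight k ^ M * ?E \<le> ((?n + 1) * B) ^ M * ?E" by (intro mult_right_mono) auto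
    also have "\<dots> = (?n + 1) ^ M * (B ^ M * ?E)" by (simp add: power_mult_distrib)
    also have "B ^ M * ?E \<le> S * cell_volume r * ?N"
    proof (cases "(real_of_int (k $ i))\<^sup>2 \<le> 1")
      case True
      have "?E \<le> ?N * cell_volume r"
        using iter_partial_le_Ck_norm[OF \<phi> r, of "[]" "2 * M"] by (intro cmod_exp_distribution_le \<phi>) simp
      also have "\<dots> = 1 * (cell_volume r * ?N)" by simp
      also have "\<dots> \<le> S * (cell_volume r * ?N)" using S1 vol N by (intro mult_right_mono) auto
      finally show ?thesis using True by (simp add: B_def mult_ac)
    next
      case False
      have k: "\<bar>real_of_int (k $ i)\<bar> = \<bar>freq r k $ i\<bar> * (r $ i / (2 * pi))"
        using r[of i] by (simp add: freq_def abs_mult)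
      have "B ^ M = \<bar>real_of_int (k $ i)\<bar> ^ (2 * M)" using False by (simp add: B_def power_mult)
      also have "\<dots> = \<bar>freq r k $ i\<bar> ^ (2 * M) * (r $ i / (2 * pi)) ^ (2 * M)"
        unfolding k by (rule power_mult_distrib)
      finally have "B ^ M * ?E = (r $ i / (2 * pi)) ^ (2 * M) * (\<bar>freq r k $ i\<bar> ^ (2 * M) * ?E)" by simp
      also have "\<dots> \<le> S * (cell_volume r * ?N)"
        using S1 by (intro mult_mono[OF Si exp_distribution_decay_coordinate[OF r \<phi>]]) auto
      finally show ?thesis by (simp add: mult_ac)
    qed
    finally show "lattice_weight k ^ M * ?E \<le> (?n + 1) ^ M * (S * cell_volume r) * ?N"
      by (simp add: mult_ac)
  qed
qed

section \<open>Trigonometric series with coefficients of polynomial growth\<close>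

text \<open>The term \<open>4 / (M + 1)\<close> makes the induction close: both sides are 1 at
  \<open>M = 0\<close>, and the two new summands are at most the telescoping difference.\<close>

lemma sum_inverse_square_le:
  "(\<Sum>j\<in>{- int M..int M}. 1 / (1 + (real_of_int j)\<^sup>2)) \<le> 5 - 4 / (real M + 1)"
proof (induction M)
  case (Suc M)
  have "{- int (Suc M)..int (Suc M)} = insert (- int (Suc M)) (insert (int (Suc M)) {- int M..int M})"
    by auto
  then have "(\<Sum>j\<in>{- int (Suc M)..int (Suc M)}. 1 / (1 + (real_of_int j)\<^sup>2))
    = 2 / (1 + (real M + 1)\<^sup>2) + (\<Sum>j\<in>{- int M..int M}. 1 / (1 + (real_of_int j)\<^sup>2))"
    by (simp add: add_ac power2_eq_square algebra_simps)
  moreover have "2 / (1 + (real M + 1)\<^sup>2) \<le> 4 / (real M + 1) - 4 / (real (Suc M) + 1)"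
  proof -
    have "4 / (real M + 1) - 4 / (real (Suc M) + 1) = 4 / ((real M + 1) * (real M + 2))"
      by (simp add: divide_simps)
    moreover have "2 / (1 + (real M + 1)\<^sup>2) \<le> 4 / ((real M + 1) * (real M + 2))"
      by (simp add: frac_le_eq divide_simps power2_eq_square algebra_simps add_nonneg_pos)
    ultimately show ?thesis by simp
  qed
  ultimately show ?case using Suc by linarith
qed simp

text \<open>Each factor \<open>1 + k_i^2\<close> is at most the weight, so the sum is bounded by a
  product of \<open>n\<close> one-dimensional sums, each at most 5.\<close>

lemma summable_lattice_weight:
  "(\<lambda>k :: int ^ 'n. 1 / lattice_weight k ^ CARD('n)) summable_on UNIV"
proof (rule nonneg_bdd_above_summable_on)
  show "1 / lattice_weight k ^ CARD('n) \<ge> 0" for k :: "int ^ 'n"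
    using lattice_weight_ge_1[of k] by simp
  show "bdd_above (sum (\<lambda>k :: int ^ 'n. 1 / lattice_weight k ^ CARD('n)) ` {F. F \<subseteq> UNIV \<and> finite F})"
  proof (rule bdd_aboveI2)
    fix F :: "(int ^ 'n) set" assume "F \<in> {F. F \<subseteq> UNIV \<and> finite F}"
    then have F: "finite F" by simp
    define w :: "int \<Rightarrow> real" where "w j = 1 / (1 + (real_of_int j)\<^sup>2)" for j
    have w: "w j \<ge> 0" for j by (simp add: w_def)
    have le: "1 / lattice_weight k ^ CARD('n) \<le> (\<Prod>i\<in>UNIV. w (k $ i))" for k :: "int ^ 'n"
    proof -
      have "(\<Prod>i\<in>UNIV. 1 + (real_of_int (k $ i))\<^sup>2) \<le> (\<Prod>i\<in>(UNIV :: 'n set). lattice_weight k)"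
        unfolding lattice_weight_def
        by (intro prod_mono conjI add_left_mono member_le_sum) auto
      moreover have "(\<Prod>i\<in>UNIV. 1 + (real_of_int (k $ i))\<^sup>2) > 0"
        by (intro prod_pos) (auto intro: add_pos_nonneg)
      ultimately have "1 / lattice_weight k ^ CARD('n) \<le> 1 / (\<Prod>i\<in>UNIV. 1 + (real_of_int (k $ i))\<^sup>2)"
        by (intro divide_left_mono) auto
      then show ?thesis by (simp add: w_def prod_dividef)
    qed
    \<comment> \<open>All coordinates occurring in \<open>F\<close>; their maximum gives a cube
      containing \<open>F\<close>. Inserting 0 covers empty \<open>F\<close>.\<close>
    define A where "A = (\<Union>k\<in>F. range (\<lambda>i. nat \<bar>k $ i\<bar>))"
    define M where "M = Max (insert 0 A)"
    have "finite A" using F by (simp add: A_def)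
    then have M: "nat \<bar>k $ i\<bar> \<le> M" if "k \<in> F" for k i
      using that by (auto simp: M_def A_def intro!: Max_ge)
    let ?P = "PiE UNIV (\<lambda>_ :: 'n. {- int M..int M})"
    have "(\<Sum>k\<in>F. 1 / lattice_weight k ^ CARD('n)) \<le> (\<Sum>k\<in>F. \<Prod>i\<in>UNIV. w (k $ i))"
      by (intro sum_mono le)
    also have "\<dots> = (\<Sum>g\<in>($) ` F. \<Prod>i\<in>UNIV. w (g i))"
      by (subst sum.reindex) (auto simp: inj_on_def vec_eq_iff fun_eq_iff)
    also have "\<dots> \<le> (\<Sum>g\<in>?P. \<Prod>i\<in>UNIV. w (g i))"
    proof (intro sum_mono2)
      show "finite ?P" by (intro finite_PiE) auto
      show "($) ` F \<subseteq> ?P"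
      proof safe
        fix k i assume "k \<in> F"
        then show "k $ i \<in> {- int M..int M}" using M[of k i] by auto
      qed auto
      show "0 \<le> (\<Prod>i\<in>UNIV. w (g i))" for g by (intro prod_nonneg) (auto simp: w)
    qed
    also have "\<dots> = (\<Prod>i\<in>(UNIV :: 'n set). \<Sum>j\<in>{- int M..int M}. w j)"
      by (subst prod_sum_PiE) auto
    also have "\<dots> \<le> (\<Prod>i\<in>(UNIV :: 'n set). 5)"
    proof (intro prod_mono conjI sum_nonneg w)
      have "4 / (real M + 1) \<ge> 0" by simp
      then show "(\<Sum>j\<in>{- int M..int M}. w j) \<le> 5"
        using sum_inverse_square_le[of M] unfolding w_def by linarith
    qed
    finally show "(\<Sum>k\<in>F. 1 / lattice_weight k ^ CARD('n)) \<le> 5 ^ CARD('n)" by simp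
  qed
qed

definition polynomial_growth :: "(int ^ 'n \<Rightarrow> complex) \<Rightarrow> bool" where
  "polynomial_growth a \<longleftrightarrow> (\<exists>C M. C \<ge> 0 \<and> (\<forall>k. cmod (a k) \<le> C * lattice_weight k ^ M))"

lemma polynomial_growth_mult:
  fixes a b :: "int ^ 'n \<Rightarrow> complex"
  assumes "polynomial_growth a" "polynomial_growth b"
  shows "polynomial_growth (\<lambda>k. a k * b k)"
proof -
  obtain C M D N where CD: "C \<ge> 0" "D \<ge> 0" "\<And>k. cmod (a k) \<le> C * lattice_weight k ^ M"
    "\<And>k. cmod (b k) \<le> D * lattice_weight k ^ N"
    using assms unfolding polynomial_growth_def by metis
  have "cmod (a k * b k) \<le> (C * D) * lattice_weight k ^ (M + N)" for k
  proof -
    have "cmod (a k * b k) \<le> (C * lattice_weight k ^ M) * (D * lattice_weight k ^ N)"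
      unfolding norm_mult using CD lattice_weight_ge_1[of k] by (intro mult_mono) auto
    then show ?thesis by (simp add: power_add mult_ac)
  qed
  moreover have "C * D \<ge> 0" using CD by simp
  ultimately show ?thesis unfolding polynomial_growth_def by blast
qed

text \<open>Of the \<open>M + n\<close> powers of decay, \<open>M\<close> compensate the growth of
  \<open>a\<close> and \<open>n\<close> give summability. The same bound yields convergence and
  continuity in \<phi>.\<close>

lemma trig_series_abs_bound:
  fixes r :: "real ^ 'n"
  assumes r: "\<And>i. r $ i > 0" and a: "polynomial_growth a"
  obtains C N where "\<And>k \<phi>. \<phi> \<in> test_functions r \<Longrightarrow>
    norm (a k * exp_distribution r k \<phi>) \<le> (C * Ck_norm N \<phi>) * (1 / lattice_weight k ^ CARD('n))"
proof -
  obtain C M where C: "C \<ge> 0" "\<And>k. cmod (a k) \<le> C * lattice_weight k ^ M"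
    using a by (auto simp: polynomial_growth_def)
  let ?n = "CARD('n)"
  obtain D where D: "\<And>k \<phi>. \<phi> \<in> test_functions r \<Longrightarrow>
    lattice_weight k ^ (M + ?n) * cmod (exp_distribution r k \<phi>) \<le> D * Ck_norm (2 * (M + ?n)) \<phi>"
    using exp_distribution_decay[OF r, of "M + ?n"] by metis
  show ?thesis
  proof (rule that[of "C * D" "2 * (M + ?n)"])
    fix k and \<phi> :: "real ^ 'n \<Rightarrow> complex" assume \<phi>: "\<phi> \<in> test_functions r"
    let ?E = "cmod (exp_distribution r k \<phi>)"
    have w: "lattice_weight k > 0" using lattice_weight_ge_1[of k] by simp
    have "norm (a k * exp_distribution r k \<phi>) \<le> C * lattice_weight k ^ M * ?E"
      unfolding norm_mult using C by (intro mult_right_mono) auto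
    also have "\<dots> = C * (lattice_weight k ^ (M + ?n) * ?E) * (1 / lattice_weight k ^ ?n)"
      using w by (simp add: power_add)
    also have "\<dots> \<le> C * (D * Ck_norm (2 * (M + ?n)) \<phi>) * (1 / lattice_weight k ^ ?n)"
      using w C D[OF \<phi>, of k] by (intro mult_right_mono mult_left_mono) auto
    finally show "norm (a k * exp_distribution r k \<phi>)
      \<le> (C * D * Ck_norm (2 * (M + ?n)) \<phi>) * (1 / lattice_weight k ^ ?n)" by (simp add: mult_ac)
  qed
qed

lemma trig_series_abs_summable:
  fixes r :: "real ^ 'n"
  assumes r: "\<And>i. r $ i > 0" and a: "polynomial_growth a" and \<phi>: "\<phi> \<in> test_functions r"
  shows "(\<lambda>k. norm (a k * exp_distribution r k \<phi>)) summable_on UNIV"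
proof -
  obtain C N where C: "\<And>k \<phi>. \<phi> \<in> test_functions r \<Longrightarrow>
    norm (a k * exp_distribution r k \<phi>) \<le> (C * Ck_norm N \<phi>) * (1 / lattice_weight k ^ CARD('n))"
    using trig_series_abs_bound[OF r a] by metis
  show ?thesis
    by (rule summable_on_comparison_test[OF summable_on_cmult_right[OF summable_lattice_weight]])
      (use C[OF \<phi>] in auto)
qed

lemma trig_series_converges_growth:
  fixes r :: "real ^ 'n"
  assumes r: "\<And>i. r $ i > 0" and a: "polynomial_growth a"
  shows "trig_series_converges r a"
  unfolding trig_series_converges_def
  using abs_summable_summable[OF trig_series_abs_summable[OF r a]] by blast

lemma exp_distribution_add:
  assumes "\<phi> \<in> test_functions r" "\<psi> \<in> test_functions r"
  shows "exp_distribution r k (\<lambda>x. \<phi> x + \<psi> x) = exp_distribution r k \<phi> + exp_distribution r k \<psi>"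
proof -
  have "(\<lambda>x. cis (freq r k \<bullet> x) * \<phi> x) integrable_on cbox 0 r" if "\<phi> \<in> test_functions r" for \<phi>
    using continuous_on_subset[OF test_functionD(2)[OF that]]
    by (intro integrable_continuous continuous_intros) auto
  then show ?thesis
    unfolding exp_distribution_def using assms by (simp add: distrib_left integral_add)
qed

lemma exp_distribution_cmult:
  "exp_distribution r k (\<lambda>x. c * \<phi> x) = c * exp_distribution r k \<phi>"
proof -
  have "exp_distribution r k (\<lambda>x. c * \<phi> x) = integral (cbox 0 r) (\<lambda>x. c * (cis (freq r k \<bullet> x) * \<phi> x))"
    by (simp add: exp_distribution_def mult_ac)
  then show ?thesis by (simp add: exp_distribution_def)
qed

lemma periodic_distribution_trig_series:
  fixes r :: "real ^ 'n"
  assumes r: "\<And>i. r $ i > 0" and a: "polynomial_growth a"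
  shows "periodic_distribution r (trig_series r a)"
  unfolding periodic_distribution_def
proof (intro conjI ballI allI)
  note abs_summable = trig_series_abs_summable[OF r a]
  note summable = abs_summable_summable[OF abs_summable]
  show "trig_series r a (\<lambda>x. \<phi> x + \<psi> x) = trig_series r a \<phi> + trig_series r a \<psi>"
    if "\<phi> \<in> test_functions r" "\<psi> \<in> test_functions r" for \<phi> \<psi>
    unfolding trig_series_def exp_distribution_add[OF that] distrib_left
    by (intro infsum_add summable that)
  show "trig_series r a (\<lambda>x. c * \<phi> x) = c * trig_series r a \<phi>" if "\<phi> \<in> test_functions r" for \<phi> c
  proof -
    have "trig_series r a (\<lambda>x. c * \<phi> x) = (\<Sum>\<^sub>\<infinity>k. c * (a k * exp_distribution r k \<phi>))"
      unfolding trig_series_def exp_distribution_cmult by (simp add: mult_ac)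
    then show ?thesis by (simp add: trig_series_def infsum_cmult_right')
  qed
  obtain C N where C: "\<And>k \<phi>. \<phi> \<in> test_functions r \<Longrightarrow>
    norm (a k * exp_distribution r k \<phi>) \<le> (C * Ck_norm N \<phi>) * (1 / lattice_weight k ^ CARD('n))"
    using trig_series_abs_bound[OF r a] by metis
  let ?S = "\<Sum>\<^sub>\<infinity>k :: int ^ 'n. 1 / lattice_weight k ^ CARD('n)"
  show "\<exists>C N. \<forall>\<phi>\<in>test_functions r. cmod (trig_series r a \<phi>) \<le> C * Ck_norm N \<phi>"
  proof (intro exI ballI)
    fix \<phi> assume \<phi>: "\<phi> \<in> test_functions r"
    have "cmod (trig_series r a \<phi>) \<le> (\<Sum>\<^sub>\<infinity>k. norm (a k * exp_distribution r k \<phi>))"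
      unfolding trig_series_def by (rule norm_infsum_bound[OF abs_summable[OF \<phi>]])
    also have "\<dots> \<le> (\<Sum>\<^sub>\<infinity>k :: int ^ 'n. (C * Ck_norm N \<phi>) * (1 / lattice_weight k ^ CARD('n)))"
      by (intro infsum_mono abs_summable[OF \<phi>] summable_on_cmult_right summable_lattice_weight C \<phi>)
    also have "\<dots> = (C * ?S) * Ck_norm N \<phi>"
      by (subst infsum_cmult_right') (simp add: mult_ac)
    finally show "cmod (trig_series r a \<phi>) \<le> (C * ?S) * Ck_norm N \<phi>" .
  qed
qed

text \<open>By orthogonality only the term \<open>j = k\<close> survives.\<close>

lemma fourier_coeff_trig_series:
  fixes r :: "real ^ 'n"
  assumes r: "\<And>i. r $ i > 0"
  shows "fourier_coeff r (trig_series r a) k = a k"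
proof -
  let ?V = "complex_of_real (\<Prod>i\<in>UNIV. r $ i)"
  have "?V \<noteq> 0" using r by (metis (no_types, lifting) less_irrefl of_real_eq_0_iff finite_class.finite_UNIV prod_zero_iff)
  have "(\<Sum>\<^sub>\<infinity>j. a j * exp_distribution r j (\<lambda>x. cis (- (freq r k \<bullet> x)))) = (\<Sum>\<^sub>\<infinity>j\<in>{k}. a j * ?V)"
    unfolding exp_distribution_exponential[OF r] by (intro infsum_cong_neutral) auto
  then show ?thesis using \<open>?V \<noteq> 0\<close> by (simp add: fourier_coeff_def trig_series_def)
qed

section \<open>Sobolev spaces and coefficients\<close>

lemma sobolev_trig_series:
  fixes r :: "real ^ 'n"
  assumes r: "\<And>i. r $ i > 0" and a: "polynomial_growth a"
    and "(\<lambda>k. lattice_weight k powr s * (cmod (a k))\<^sup>2) summable_on UNIV"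
  shows "trig_series r a \<in> sobolev r s"
  using assms by (simp add: sobolev_def periodic_distribution_trig_series fourier_coeff_trig_series
      lattice_weight_def)

text \<open>A single term of a summable nonnegative family is at most its sum.\<close>

lemma sobolev_coeff_growth:
  assumes "f \<in> sobolev r s"
  shows "polynomial_growth (fourier_coeff r f)"
proof -
  let ?h = "\<lambda>k. lattice_weight k powr s * (cmod (fourier_coeff r f k))\<^sup>2"
  have sum: "?h summable_on UNIV" using assms by (simp add: sobolev_def lattice_weight_def)
  define B where "B = infsum ?h UNIV"
  have B: "?h k \<le> B" for k
    using finite_sum_le_infsum[OF sum, of "{k}"] by (simp add: B_def)
  have "B \<ge> 0" unfolding B_def by (intro infsum_nonneg) auto
  \<comment> \<open>The weight is at least 1, so its power \<open>2 * M\<close> dominates its power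
    \<open>- s\<close>; the even exponent allows the square root.\<close>
  obtain M :: nat where M: "\<bar>s\<bar> \<le> real M" using real_arch_simple by blast
  have "cmod (fourier_coeff r f k) \<le> sqrt B * lattice_weight k ^ M" for k
  proof -
    have w: "lattice_weight k \<ge> 1" by (rule lattice_weight_ge_1)
    have "(cmod (fourier_coeff r f k))\<^sup>2 = lattice_weight k powr (- s) * ?h k"
      using w by (simp add: powr_minus)
    also have "\<dots> \<le> lattice_weight k powr (- s) * B" using B by (intro mult_left_mono) auto
    also have "\<dots> \<le> lattice_weight k powr real (2 * M) * B"
      using w M \<open>B \<ge> 0\<close> by (intro mult_right_mono powr_mono) auto
    also have "\<dots> = (sqrt B * lattice_weight k ^ M)\<^sup>2"
    proof -
      have "lattice_weight k powr real (2 * M) = lattice_weight k ^ (2 * M)"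
        using w by (intro powr_realpow) auto
      then show ?thesis using \<open>B \<ge> 0\<close>
        by (simp only: power_mult_distrib real_sqrt_pow2 power_mult[symmetric] mult.commute)
    qed
    finally show ?thesis by (rule power2_le_imp_le) (use w \<open>B \<ge> 0\<close> in simp)
  qed
  moreover have "sqrt B \<ge> 0" using \<open>B \<ge> 0\<close> by simp
  ultimately show ?thesis unfolding polynomial_growth_def by blast
qed

lemma sobolev_multiplied_coeffs:
  fixes r :: "real ^ 'n" and g :: "int ^ 'n \<Rightarrow> real"
  assumes r: "\<And>i. r $ i > 0" and f: "f \<in> sobolev r s"
    and g: "polynomial_growth (\<lambda>k. of_real (g k))"
    and K: "\<And>k. lattice_weight k powr \<sigma> * (g k)\<^sup>2 \<le> K"
  shows "trig_series r (\<lambda>k. fourier_coeff r f k * of_real (g k)) \<in> sobolev r (s + \<sigma>)"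
proof (rule sobolev_trig_series[OF r])
  show "polynomial_growth (\<lambda>k. fourier_coeff r f k * of_real (g k))"
    by (intro polynomial_growth_mult sobolev_coeff_growth[OF f] g)
  let ?h = "\<lambda>k. lattice_weight k powr s * (cmod (fourier_coeff r f k))\<^sup>2"
  have sum: "?h summable_on UNIV" using f by (simp add: sobolev_def lattice_weight_def)
  show "(\<lambda>k. lattice_weight k powr (s + \<sigma>) * (cmod (fourier_coeff r f k * of_real (g k)))\<^sup>2) summable_on UNIV"
  proof (rule summable_on_comparison_test[OF summable_on_cmult_right[OF sum, of K]])
    fix k
    have "lattice_weight k powr (s + \<sigma>) * (cmod (fourier_coeff r f k * of_real (g k)))\<^sup>2
      = (lattice_weight k powr \<sigma> * (g k)\<^sup>2) * ?h k"
      by (simp add: powr_add norm_mult power_mult_distrib mult_ac)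
    also have "\<dots> \<le> K * ?h k" using K by (intro mult_right_mono) auto
    finally show "lattice_weight k powr (s + \<sigma>) * (cmod (fourier_coeff r f k * of_real (g k)))\<^sup>2 \<le> K * ?h k" .
  qed auto
qed

section \<open>Smoothing by the multiplier\<close>

text \<open>The squared norm of the frequency is a diagonal quadratic form in \<open>k\<close> with
  positive entries. This links the bounds on the multiplier, stated in \<nu>, to the Sobolev
  weights, stated in \<open>k\<close>.\<close>

lemma freq_norm_weight:
  fixes r :: "real ^ 'n"
  assumes r: "\<And>i. r $ i > 0"
  obtains c C where "c > 0" "C > 0"
    and "\<And>k. c * lattice_weight k \<le> 1 + (norm (freq r k))\<^sup>2"
    and "\<And>k. 1 + (norm (freq r k))\<^sup>2 \<le> C * lattice_weight k"
proof -
  define d where "d i = (2 * pi / r $ i)\<^sup>2" for i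
  define c where "c = min 1 (Min (range d))"
  define C where "C = 1 + (\<Sum>i\<in>UNIV. d i)"
  have d: "d i > 0" for i using r[of i] by (simp add: d_def)
  have n: "(norm (freq r k))\<^sup>2 = (\<Sum>i\<in>UNIV. d i * (real_of_int (k $ i))\<^sup>2)" for k
    unfolding power2_norm_eq_inner inner_vec_def
    by (intro sum.cong) (auto simp: freq_def d_def power2_eq_square)
  show ?thesis
  proof (rule that[of c C])
    show c: "c > 0" using d by (simp add: c_def)
    show "C > 0" using d by (simp add: C_def add_pos_nonneg sum_nonneg less_imp_le)
    fix k :: "int ^ 'n"
    have cd: "c \<le> d i" for i
    proof -
      have "Min (range d) \<le> d i" by (rule Min_le) auto
      then show ?thesis unfolding c_def by (rule min.coboundedI2)
    qed
    have "c * lattice_weight k = c + (\<Sum>i\<in>UNIV. c * (real_of_int (k $ i))\<^sup>2)"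
      by (simp add: lattice_weight_def distrib_left sum_distrib_left)
    also have "\<dots> \<le> 1 + (\<Sum>i\<in>UNIV. d i * (real_of_int (k $ i))\<^sup>2)"
      using cd by (intro add_mono sum_mono mult_right_mono) (auto simp: c_def)
    finally show "c * lattice_weight k \<le> 1 + (norm (freq r k))\<^sup>2" by (simp add: n)
    have dC: "d i \<le> C" for i
      using member_le_sum[of i UNIV d] d by (simp add: C_def less_imp_le)
    have "1 + (norm (freq r k))\<^sup>2 \<le> C + (\<Sum>i\<in>UNIV. C * (real_of_int (k $ i))\<^sup>2)"
      unfolding n using dC d by (intro add_mono sum_mono mult_right_mono) (auto simp: C_def sum_nonneg less_imp_le)
    also have "\<dots> = C * lattice_weight k"
      by (simp add: lattice_weight_def distrib_left sum_distrib_left)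
    finally show "1 + (norm (freq r k))\<^sup>2 \<le> C * lattice_weight k" .
  qed
qed

text \<open>Exponentiating the logarithmic bound turns it into a power of the weight. The factor 2
  is there because coefficients enter the Sobolev norm squared.\<close>

lemma exp_multiplier_weight_bounded:
  fixes r :: "real ^ 'n" and m :: "real ^ 'n \<Rightarrow> real"
  assumes r: "\<And>i. r $ i > 0" and "M \<ge> 0" "\<tau> \<ge> 0"
    and m: "\<And>\<nu>. m \<nu> \<le> K - M * ln (1 + (norm \<nu>)\<^sup>2)"
  shows "\<exists>L. \<forall>k. lattice_weight k powr (2 * M * \<tau>) * exp (2 * m (freq r k) * \<tau>) \<le> L"
proof -
  obtain c where c: "c > 0" "\<And>k. c * lattice_weight k \<le> 1 + (norm (freq r k))\<^sup>2"
    using freq_norm_weight[OF r] by metis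
  show ?thesis
  proof (intro exI allI)
    fix k :: "int ^ 'n"
    define w where "w = lattice_weight k"
    have w: "w > 0" using lattice_weight_ge_1[of k] by (simp add: w_def)
    have "ln c + ln w = ln (c * w)" using c(1) w by (simp add: ln_mult)
    also have "\<dots> \<le> ln (1 + (norm (freq r k))\<^sup>2)" using c w by (intro ln_mono) (auto simp: w_def)
    finally have "M * (ln c + ln w) \<le> M * ln (1 + (norm (freq r k))\<^sup>2)"
      using assms by (intro mult_left_mono) auto
    then have "m (freq r k) \<le> K - M * (ln c + ln w)" using m[of "freq r k"] by linarith
    then have "2 * \<tau> * m (freq r k) \<le> 2 * \<tau> * (K - M * (ln c + ln w))"
      using assms by (intro mult_left_mono) auto
    then have "2 * M * \<tau> * ln w + 2 * m (freq r k) * \<tau> \<le> 2 * \<tau> * (K - M * ln c)"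
      by (simp add: algebra_simps)
    then have "exp (2 * M * \<tau> * ln w + 2 * m (freq r k) * \<tau>) \<le> exp (2 * \<tau> * (K - M * ln c))" by simp
    then show "lattice_weight k powr (2 * M * \<tau>) * exp (2 * m (freq r k) * \<tau>) \<le> exp (2 * \<tau> * (K - M * ln c))"
      using w by (simp add: exp_add powr_def w_def)
  qed
qed

text \<open>From \<open>1 + u \<le> exp u\<close> at \<open>u = - y * \<tau>\<close>.\<close>

lemma times_exp_le:
  fixes y \<tau> :: real
  assumes "y \<le> 0" "\<tau> > 0"
  shows "(y * exp (y * \<tau>))\<^sup>2 \<le> (1 / \<tau>)\<^sup>2"
proof -
  have "- y * \<tau> \<le> exp (- (y * \<tau>))" using exp_ge_add_one_self[of "- (y * \<tau>)"] by linarith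
  then have "- y * \<tau> * exp (y * \<tau>) \<le> exp (- (y * \<tau>)) * exp (y * \<tau>)" by (intro mult_right_mono) auto
  also have "\<dots> = 1" by (simp add: exp_minus)
  finally have "- (y * exp (y * \<tau>)) \<le> 1 / \<tau>" using assms by (simp add: field_simps)
  moreover have "y * exp (y * \<tau>) \<le> 0" using assms by (simp add: mult_nonpos_nonneg)
  ultimately have "\<bar>y * exp (y * \<tau>)\<bar> \<le> \<bar>1 / \<tau>\<bar>" by linarith
  then show ?thesis by (simp only: abs_le_square_iff)
qed

lemma multiplier_growth:
  fixes r :: "real ^ 'n"
  assumes r: "\<And>i. r $ i > 0" and \<beta>: "\<beta> < real CARD('n) + 4" and t: "t \<ge> 0"
  shows "polynomial_growth (\<lambda>k. of_real (exp (multiplier \<delta> \<beta> (freq r k) * t)))" (is ?A)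
    and "polynomial_growth (\<lambda>k. of_real (multiplier \<delta> \<beta> (freq r k) * exp (multiplier \<delta> \<beta> (freq r k) * t)))"
      (is ?B)
proof -
  let ?m = "\<lambda>k. multiplier \<delta> \<beta> (freq r k)"
  have m: "?m k \<le> 0" for k using \<beta> by (rule multiplier_nonpos)
  have "cmod (of_real (exp (?m k * t))) \<le> 1 * lattice_weight k ^ 0" for k
    using m[of k] t by (simp add: mult_nonpos_nonneg)
  then show A: ?A unfolding polynomial_growth_def using zero_le_one by blast
  obtain C where C: "C \<ge> 0" "\<And>\<nu> :: real ^ 'n. - multiplier \<delta> \<beta> \<nu> \<le> C * (1 + (norm \<nu>)\<^sup>2) ^ 2"
    using multiplier_lower_bound[OF \<beta>] by metis
  obtain D where D: "D > 0" "\<And>k. 1 + (norm (freq r k))\<^sup>2 \<le> D * lattice_weight k"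
    using freq_norm_weight[OF r] by metis
  have "cmod (of_real (?m k)) \<le> (C * D\<^sup>2) * lattice_weight k ^ 2" for k
  proof -
    have "cmod (of_real (?m k)) = - ?m k" using m[of k] by simp
    also have "\<dots> \<le> C * (1 + (norm (freq r k))\<^sup>2) ^ 2" by (rule C)
    also have "\<dots> \<le> C * (D * lattice_weight k) ^ 2"
      using C D by (intro mult_left_mono power_mono) auto
    finally show ?thesis by (simp add: power_mult_distrib mult_ac)
  qed
  moreover have "C * D\<^sup>2 \<ge> 0" using C by simp
  ultimately have "polynomial_growth (\<lambda>k. of_real (?m k))" unfolding polynomial_growth_def by blast
  from polynomial_growth_mult[OF this A] show ?B by simp
qed

text \<open>The exponential is split into the shares \<open>1 - \<epsilon>\<close> and \<epsilon> of
  the time. The first pays for the weight; the second is bounded by 1 for \<open>?U\<close> and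
  absorbs the factor \<open>m\<close> for \<open>?V\<close>.\<close>

lemma sobolev_gain:
  fixes r :: "real ^ 'n"
  assumes r: "\<And>i. r $ i > 0" and \<beta>: "\<beta> < real CARD('n) + 4" and t: "t > 0"
    and f: "f \<in> sobolev r s" and \<epsilon>: "0 < \<epsilon>"
    and L: "\<And>k. lattice_weight k powr \<sigma> * exp (2 * multiplier \<delta> \<beta> (freq r k) * ((1 - \<epsilon>) * t)) \<le> L"
  shows "trig_series r (\<lambda>k. fourier_coeff r f k * of_real (exp (multiplier \<delta> \<beta> (freq r k) * t)))
      \<in> sobolev r (s + \<sigma>)" (is ?U)
    and "trig_series r (\<lambda>k. fourier_coeff r f k *
      of_real (multiplier \<delta> \<beta> (freq r k) * exp (multiplier \<delta> \<beta> (freq r k) * t))) \<in> sobolev r (s + \<sigma>)" (is ?V)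
proof -
  let ?m = "\<lambda>k. multiplier \<delta> \<beta> (freq r k)"
  let ?E = "\<lambda>k. exp (2 * ?m k * ((1 - \<epsilon>) * t))"
  have m: "?m k \<le> 0" for k using \<beta> by (rule multiplier_nonpos)
  have split: "(exp (?m k * t))\<^sup>2 = ?E k * (exp (?m k * (\<epsilon> * t)))\<^sup>2" for k
    by (simp add: power2_eq_square exp_add[symmetric] algebra_simps)
  show ?U
  proof (rule sobolev_multiplied_coeffs[OF r f])
    fix k
    have "(exp (?m k * (\<epsilon> * t)))\<^sup>2 \<le> 1"
      using m[of k] \<epsilon> t by (intro power_le_one) (auto simp: mult_nonpos_nonneg)
    then have "lattice_weight k powr \<sigma> * (exp (?m k * t))\<^sup>2 \<le> lattice_weight k powr \<sigma> * (?E k * 1)"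
      unfolding split by (intro mult_left_mono) auto
    also have "\<dots> \<le> L" using L by simp
    finally show "lattice_weight k powr \<sigma> * (exp (?m k * t))\<^sup>2 \<le> L" .
  qed (use multiplier_growth(1)[OF r \<beta>] t in auto)
  show ?V
  proof (rule sobolev_multiplied_coeffs[OF r f])
    fix k
    have "(?m k * exp (?m k * t))\<^sup>2 = ?E k * (?m k * exp (?m k * (\<epsilon> * t)))\<^sup>2"
      unfolding power_mult_distrib split by (simp add: mult_ac)
    also have "\<dots> \<le> ?E k * (1 / (\<epsilon> * t))\<^sup>2"
      using times_exp_le[OF m, of "\<epsilon> * t" k] \<epsilon> t by (intro mult_left_mono) auto
    finally have "lattice_weight k powr \<sigma> * (?m k * exp (?m k * t))\<^sup>2
      \<le> lattice_weight k powr \<sigma> * (?E k * (1 / (\<epsilon> * t))\<^sup>2)" by (intro mult_left_mono) auto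
    also have "\<dots> = (lattice_weight k powr \<sigma> * ?E k) * (1 / (\<epsilon> * t))\<^sup>2" by simp
    also have "\<dots> \<le> L * (1 / (\<epsilon> * t))\<^sup>2" using L by (intro mult_right_mono) auto
    finally show "lattice_weight k powr \<sigma> * (?m k * exp (?m k * t))\<^sup>2 \<le> L * (1 / (\<epsilon> * t))\<^sup>2" .
  qed (use multiplier_growth(2)[OF r \<beta>] t in auto)
qed

text \<open>For \<open>\<beta> = n\<close> the logarithmic factor
  \<open>2 n / \<delta>\<^sup>2\<close> gives exactly the stated exponent; for
  \<open>\<beta> > n\<close> the hypotheses leave \<sigma> arbitrary.\<close>

lemma exp_multiplier_decay:
  fixes r :: "real ^ 'n"
  assumes r: "\<And>i. r $ i > 0" and \<delta>: "\<delta> > 0" and \<beta>: "\<beta> < real CARD('n) + 4" and \<tau>: "\<tau> > 0"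
    and \<sigma>: "\<beta> < real CARD('n) \<Longrightarrow> \<sigma> = 0" "\<beta> = real CARD('n) \<Longrightarrow> \<sigma> = 4 * real CARD('n) * \<tau> / \<delta>\<^sup>2"
  shows "\<exists>L. \<forall>k. lattice_weight k powr \<sigma> * exp (2 * multiplier \<delta> \<beta> (freq r k) * \<tau>) \<le> L"
proof -
  consider "\<beta> < real CARD('n)" | "\<beta> = real CARD('n)" | "\<beta> > real CARD('n)" by linarith
  then show ?thesis
  proof cases
    case 1
    have "lattice_weight k powr \<sigma> * exp (2 * multiplier \<delta> \<beta> (freq r k) * \<tau>) \<le> 1" for k
      using \<sigma>(1)[OF 1] multiplier_nonpos[OF \<beta>, of \<delta> "freq r k"] \<tau> lattice_weight_ge_1[of k]
      by (simp add: mult_nonpos_nonneg)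
    then show ?thesis by blast
  next
    case 2
    have "\<exists>K. \<forall>\<nu> :: real ^ 'n. multiplier \<delta> \<beta> \<nu> \<le> K - 2 * real CARD('n) / \<delta>\<^sup>2 * ln (1 + (norm \<nu>)\<^sup>2)"
      unfolding 2 by (rule multiplier_le_log[OF \<delta>])
    then obtain K where K: "\<And>\<nu> :: real ^ 'n. multiplier \<delta> \<beta> \<nu> \<le> K - 2 * real CARD('n) / \<delta>\<^sup>2 * ln (1 + (norm \<nu>)\<^sup>2)"
      by blast
    from exp_multiplier_weight_bounded[where M = "2 * real CARD('n) / \<delta>\<^sup>2" and m = "multiplier \<delta> \<beta>", OF r _ _ K, of \<tau>]
    show ?thesis using \<tau> \<sigma>(2)[OF 2] by simp
  next
    case 3
    \<comment> \<open>Gives \<open>2 * M * \<tau> \<ge> \<sigma>\<close>, and the summand 1 keeps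
      \<open>M\<close> positive.\<close>
    define M where "M = (\<bar>\<sigma>\<bar> + 1) / (2 * \<tau>)"
    have M: "M > 0" using \<tau> by (simp add: M_def)
    obtain K where K: "\<And>\<nu> :: real ^ 'n. multiplier \<delta> \<beta> \<nu> \<le> K - M * ln (1 + (norm \<nu>)\<^sup>2)"
      using multiplier_superlog[OF \<delta> 3 \<beta> M] by blast
    from exp_multiplier_weight_bounded[where M = M and m = "multiplier \<delta> \<beta>", OF r _ _ K, of \<tau>]
    obtain L where L: "\<And>k. lattice_weight k powr (2 * M * \<tau>) * exp (2 * multiplier \<delta> \<beta> (freq r k) * \<tau>) \<le> L"
      using \<tau> M by auto
    have "\<sigma> \<le> 2 * M * \<tau>" using \<tau> by (simp add: M_def)
    have "lattice_weight k powr \<sigma> * exp (2 * multiplier \<delta> \<beta> (freq r k) * \<tau>) \<le> L" for k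
    proof -
      have "lattice_weight k powr \<sigma> \<le> lattice_weight k powr (2 * M * \<tau>)"
        using lattice_weight_ge_1 \<open>\<sigma> \<le> 2 * M * \<tau>\<close> by (rule powr_mono[rotated])
      then have "lattice_weight k powr \<sigma> * exp (2 * multiplier \<delta> \<beta> (freq r k) * \<tau>)
          \<le> lattice_weight k powr (2 * M * \<tau>) * exp (2 * multiplier \<delta> \<beta> (freq r k) * \<tau>)"
        by (intro mult_right_mono) auto
      then show ?thesis using L[of k] by linarith
    qed
    then show ?thesis by blast
  qed
qed

lemma sobolev_ereal_gain:
  fixes r :: "real ^ 'n"
  assumes r: "\<And>i. r $ i > 0" and \<delta>: "\<delta> > 0" and \<beta>: "\<beta> < real CARD('n) + 4" and t: "t > 0"
    and f: "f \<in> sobolev r s" and \<epsilon>: "0 < \<epsilon>" "\<epsilon> < 1"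
  defines "p \<equiv> (if \<beta> < real CARD('n) then ereal s
        else if \<beta> = real CARD('n) then ereal (s + 4 * real CARD('n) * t / \<delta>\<^sup>2 * (1 - \<epsilon>))
        else \<infinity>)"
  shows "trig_series r (\<lambda>k. fourier_coeff r f k * of_real (exp (multiplier \<delta> \<beta> (freq r k) * t)))
      \<in> sobolev_ereal r p"
    and "trig_series r (\<lambda>k. fourier_coeff r f k *
      of_real (multiplier \<delta> \<beta> (freq r k) * exp (multiplier \<delta> \<beta> (freq r k) * t))) \<in> sobolev_ereal r p"
proof -
  let ?U = "trig_series r (\<lambda>k. fourier_coeff r f k * of_real (exp (multiplier \<delta> \<beta> (freq r k) * t)))"
  let ?V = "trig_series r (\<lambda>k. fourier_coeff r f k *
      of_real (multiplier \<delta> \<beta> (freq r k) * exp (multiplier \<delta> \<beta> (freq r k) * t)))"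
  have \<tau>: "(1 - \<epsilon>) * t > 0" using \<epsilon> t by simp
  have gain: "?U \<in> sobolev r (s + \<sigma>) \<and> ?V \<in> sobolev r (s + \<sigma>)"
    if \<sigma>: "\<beta> < real CARD('n) \<Longrightarrow> \<sigma> = 0"
      "\<beta> = real CARD('n) \<Longrightarrow> \<sigma> = 4 * real CARD('n) * ((1 - \<epsilon>) * t) / \<delta>\<^sup>2" for \<sigma>
  proof -
    obtain L where "\<And>k. lattice_weight k powr \<sigma> * exp (2 * multiplier \<delta> \<beta> (freq r k) * ((1 - \<epsilon>) * t)) \<le> L"
      using exp_multiplier_decay[OF r \<delta> \<beta> \<tau> \<sigma>] by blast
    from sobolev_gain[OF r \<beta> t f \<epsilon>(1) this] show ?thesis by (rule conjI)
  qed
  have "?U \<in> sobolev_ereal r p \<and> ?V \<in> sobolev_ereal r p"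
  proof -
    consider "\<beta> < real CARD('n)" | "\<beta> = real CARD('n)" | "\<beta> > real CARD('n)" by linarith
    then show ?thesis
    proof cases
      case 1
      then show ?thesis using gain[of 0] by (simp add: p_def sobolev_ereal_def)
    next
      case 2
      then show ?thesis using gain[of "4 * real CARD('n) * t / \<delta>\<^sup>2 * (1 - \<epsilon>)"]
        by (simp add: p_def sobolev_ereal_def mult_ac)
    next
      case 3
      \<comment> \<open>Above the critical exponent any gain is allowed, so every order is
        reached.\<close>
      have "?U \<in> sobolev r s' \<and> ?V \<in> sobolev r s'" for s' using gain[of "s' - s"] 3 by simp
      moreover have "sobolev_ereal r p = (\<Inter>s'. sobolev r s')"
      proof -
        have "p = \<infinity>" using 3 by (simp add: p_def)
        then show ?thesis by (simp only: sobolev_ereal_def infinity_ereal_def ereal.case)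
      qed
      ultimately show ?thesis by blast
    qed
  qed
  then show "?U \<in> sobolev_ereal r p" "?V \<in> sobolev_ereal r p" by auto
qed

theorem theorem3:
  fixes r :: "real ^ 'n"
    and \<delta> \<beta> \<epsilon>1 \<epsilon>2 s :: real
    and f :: "(real ^ 'n \<Rightarrow> complex) \<Rightarrow> complex"
    and U V :: "real \<Rightarrow> (real ^ 'n \<Rightarrow> complex) \<Rightarrow> complex"
    and m :: "real ^ 'n \<Rightarrow> real"
    and a b :: "real \<Rightarrow> int ^ 'n \<Rightarrow> complex"
    and p q :: "real \<Rightarrow> ereal"
  assumes r_pos: "\<forall>i. r $ i > 0"
    and \<delta>: "\<delta> > 0"
    and \<beta>: "\<beta> < real CARD('n) + 4"
    and \<epsilon>: "0 < \<epsilon>1" "\<epsilon>1 < \<epsilon>2" "\<epsilon>2 < 1"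
    and f: "f \<in> sobolev r s"
    and m: "m = multiplier \<delta> \<beta>"
    and a: "\<And>t k. a t k = fourier_coeff r f k * of_real (exp (m (freq r k) * t))"
    and b: "\<And>t k. b t k =
        fourier_coeff r f k * of_real (m (freq r k) * exp (m (freq r k) * t))"
    and U: "\<And>t. t \<ge> 0 \<Longrightarrow> U t = trig_series r (a t)"
    and V: "\<And>t. t \<ge> 0 \<Longrightarrow> V t = trig_series r (b t)"
    and p: "\<And>t. p t = (if \<beta> < real CARD('n) then ereal s
        else if \<beta> = real CARD('n)
          then ereal (s + 4 * real CARD('n) * t / \<delta>\<^sup>2 * (1 - \<epsilon>1))
        else \<infinity>)"
    and q: "\<And>t. q t = (if \<beta> < real CARD('n) then ereal s
        else if \<beta> = real CARD('n)
          then ereal (s + 4 * real CARD('n) * t / \<delta>\<^sup>2 * (1 - \<epsilon>2))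
        else \<infinity>)"
  shows "(\<forall>t\<ge>0. trig_series_converges r (a t) \<and> trig_series_converges r (b t)) \<and>
    (\<forall>t>0. U t \<in> sobolev_ereal r (p t) \<and> V t \<in> sobolev_ereal r (q t))"
proof (intro conjI allI impI)
  fix t :: real
  have r: "r $ i > 0" for i using r_pos by blast
  have a': "a t = (\<lambda>k. fourier_coeff r f k * of_real (exp (multiplier \<delta> \<beta> (freq r k) * t)))"
    by (simp add: fun_eq_iff a m)
  have b': "b t = (\<lambda>k. fourier_coeff r f k *
      of_real (multiplier \<delta> \<beta> (freq r k) * exp (multiplier \<delta> \<beta> (freq r k) * t)))"
    by (simp add: fun_eq_iff b m)
  show "trig_series_converges r (a t)" "trig_series_converges r (b t)" if t: "0 \<le> t"
    unfolding a' b'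
    by (intro trig_series_converges_growth polynomial_growth_mult sobolev_coeff_growth[OF f]
        multiplier_growth[OF _ \<beta> t] r)+
  show "U t \<in> sobolev_ereal r (p t)" "V t \<in> sobolev_ereal r (q t)" if t: "0 < t"
  proof -
    have \<epsilon>': "\<epsilon>1 < 1" "0 < \<epsilon>2" using \<epsilon> by auto
    have UV: "U t = trig_series r (a t)" "V t = trig_series r (b t)" using U V t by auto
    show "U t \<in> sobolev_ereal r (p t)"
      unfolding UV a' p by (rule sobolev_ereal_gain(1)[OF r \<delta> \<beta> t f \<epsilon>(1) \<epsilon>'(1)])
    show "V t \<in> sobolev_ereal r (q t)"
      unfolding UV b' q by (rule sobolev_ereal_gain(2)[OF r \<delta> \<beta> t f \<epsilon>'(2) \<epsilon>(3)])
  qed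
qed

end
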